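(* Let $u,v\in S_{\mathbb{Z}_+}$. For all $i\in\mathbb{Z}$, \[\max_{w\,:\,\overleftarrow{c_{u,v}^w}\neq 0} I_i(\mathcal{RW}(w))=I_i(\mathcal{RW}(u))+I_i(\mathcal{RW}(v)).\] In particular, if for some $i$, $I_i(\mathcal{RW}(w))>I_i(\mathcal{RW}(u))+I_i(\mathcal{RW}(v))$, then $\overleftarrow{c_{u,v}^w}=0$.
   Context: $S_{\mathbb{Z}}$: bijections of $\mathbb{Z}$ fixing all but finitely many integers; $S_{\mathbb{Z}_+}$: those fixing every integer $\le 0$. $s_i=(i\ i{+}1)$; $\mathcal{RW}(w)$ is the set of reduced words $(w_1,\dots,w_k)$ of $w$ ($w=s_{w_1}\cdots s_{w_k}$, $k$ minimal). For an integer word $t=(t_1,\dots,t_k)$, a bottom row is a weakly increasing $b\in\mathbb{Z}^k$ with $b_j\le t_j$ and $b_j<b_{j+1}$ whenever $t_j<t_{j+1}$; $\overleftarrow{\mathfrak{S}}_w=\sum_{t\in\mathcal{RW}(w)}\sum_b x_{b_1}\cdots x_{b_k}$ (power series in $x_i$, $i\in\mathbb{Z}$), and the back-stable structure constants are defined by $\overleftarrow{\mathfrak{S}}_u\overleftarrow{\mathfrak{S}}_v=\sum_w\overleftarrow{c_{u,v}^w}\overleftarrow{\mathfrak{S}}_w$. For a word $p=(p_1,\dots,p_k)$, $I(p)$ is the length of its longest strictly increasing suffix ($0$ for the empty word), and $I_i(p)=I(p)$ if $k\ge1$ and $p_k\le i$, $I_i(p)=0$ otherwise. For a set $X$ of words,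 $I_i(X)=\max_{p\in X}I_i(p)$. *)

theory Defs
  imports Main "HOL-Library.Multiset" "HOL-Library.Sublist" "HOL-Combinatorics.Transposition"
begin

definition S_Z :: "(int \<Rightarrow> int) set" where
  "S_Z = {w. bij w \<and> finite {i. w i \<noteq> i}}"

definition S_Z_plus :: "(int \<Rightarrow> int) set" where
  "S_Z_plus = {w \<in> S_Z. \<forall>i\<le>0. w i = i}"

definition simple_refl :: "int \<Rightarrow> int \<Rightarrow> int" where
  "simple_refl i = Transposition.transpose i (i + 1)"

definition word_perm :: "int list \<Rightarrow> int \<Rightarrow> int" where
  "word_perm t = foldr (\<lambda>i f. simple_refl i \<circ> f) t id"

definition RW :: "(int \<Rightarrow> int) \<Rightarrow> int list set" where
  "RW w = {t. word_perm t = w \<and> (\<forall>t'. word_perm t' = w \<longrightarrow> length t \<le> length t')}"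

definition bottom_row :: "int list \<Rightarrow> int list \<Rightarrow> bool" where
  "bottom_row t b \<longleftrightarrow>
     length b = length t \<and> sorted b \<and>
     (\<forall>j<length t. b ! j \<le> t ! j) \<and>
     (\<forall>j. Suc j < length t \<and> t ! j < t ! Suc j \<longrightarrow> b ! j < b ! Suc j)"

text \<open>
  A power series in the variables \<open>x\<^sub>i\<close> (\<open>i\<close> an integer) is represented by its coefficient
  function; the monomial \<open>x\<^sub>b\<^sub>1 \<cdots> x\<^sub>b\<^sub>k\<close> is the multiset of its indices.
\<close>

type_synonym int_series = "int multiset \<Rightarrow> int"

definition series_mult :: "int_series \<Rightarrow> int_series \<Rightarrow> int_series" where
  "series_mult f g = (\<lambda>m. \<Sum>(a, b)\<in>{(a, b). a + b = m}. f a * g b)"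

text \<open>
  Both the set of reduced words of \<open>w \<in> S_Z\<close> and the set of lists with a given multiset of
  entries are finite, so the sum and the cardinality below are genuine.
\<close>

definition back_stable_schubert :: "(int \<Rightarrow> int) \<Rightarrow> int_series" where
  "back_stable_schubert w =
     (\<lambda>m. \<Sum>t\<in>RW w. int (card {b. bottom_row t b \<and> mset b = m}))"

text \<open>
  The back-stable Schubert series are linearly independent and every product of two of them is
  a finite integer combination of them, so the description below is satisfied by exactly one
  function when \<open>u\<close> and \<open>v\<close> are in \<open>S_Z\<close>. It vanishes outside \<open>S_Z\<close>.
\<close>

definition back_stable_coeff ::
    "(int \<Rightarrow> int) \<Rightarrow> (int \<Rightarrow> int) \<Rightarrow> (int \<Rightarrow> int) \<Rightarrow> int" where
  "back_stable_coeff u v =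
     (THE c. finite {w. c w \<noteq> 0} \<and> {w. c w \<noteq> 0} \<subseteq> S_Z \<and>
        series_mult (back_stable_schubert u) (back_stable_schubert v) =
          (\<lambda>m. \<Sum>w | c w \<noteq> 0. c w * back_stable_schubert w m))"

definition inc_suffix :: "int list \<Rightarrow> nat" where
  "inc_suffix p = Max {length s | s. suffix s p \<and> sorted_wrt (<) s}"

definition inc_suffix_le :: "int \<Rightarrow> int list \<Rightarrow> nat" where
  "inc_suffix_le i p = (if p \<noteq> [] \<and> last p \<le> i then inc_suffix p else 0)"

definition max_inc_suffix_le :: "int \<Rightarrow> int list set \<Rightarrow> nat" where
  "max_inc_suffix_le i X = Max (inc_suffix_le i ` X)"

end

theory Submission
  imports Defs
begin

text \<open>
  Write \<open>\<partial>\<^sub>a\<close> for the divided differences. As \<open>\<partial>\<^sub>a \<SS>\<^sub>w\<close> is \<open>\<SS>\<close> of \<open>w s\<^sub>a\<close> if \<open>a\<close> is a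
  descent of \<open>w\<close> and \<open>0\<close> otherwise, \<open>I\<^sub>i(w)\<close> is the largest size of a set
  \<open>A = {a\<^sub>1 < \<cdots> < a\<^sub>r}\<close> of integers \<open>\<le> i\<close> such that
  \<open>\<partial>\<^sub>A = \<partial>\<^sub>a\<^sub>1 \<cdots> \<partial>\<^sub>a\<^sub>r\<close> does not annihilate \<open>\<SS>\<^sub>w\<close>.

  Iterating the Leibniz rule \<open>\<partial>\<^sub>a (f g) = \<partial>\<^sub>a f g + s\<^sub>a f \<partial>\<^sub>a g\<close> with
  \<open>s\<^sub>a f = f - (x\<^sub>a - x\<^sub>a\<^sub>+\<^sub>1) \<partial>\<^sub>a f\<close> gives
  \<open>\<partial>\<^sub>A (f g) = \<Sum>J K. P\<^sub>J\<^sub>K \<partial>\<^sub>J f \<partial>\<^sub>K g\<close>, where \<open>P\<^sub>J\<^sub>K\<close> is a homogeneous polynomial of degree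
  \<open>|J| + |K| - |A|\<close>. Hence \<open>\<partial>\<^sub>A (\<SS>\<^sub>u \<SS>\<^sub>v) = 0\<close> for \<open>|A| > I\<^sub>i(u) + I\<^sub>i(v)\<close>, which is the upper
  bound. If \<open>|A| = I\<^sub>i(u) + I\<^sub>i(v)\<close>, only constants \<open>P\<^sub>J\<^sub>K\<close> contribute; they are nonnegative, and
  for every \<open>J\<close> and \<open>K\<close> some \<open>A\<close> has \<open>P\<^sub>J\<^sub>K = 1\<close>, so positivity of the coefficients
  of the \<open>\<SS>\<^sub>w\<close> shows that the bound is attained.

  The action of \<open>\<partial>\<^sub>a\<close> on \<open>\<SS>\<^sub>w\<close> follows Fomin and Stanley: summing over the blocks of equal entries
  of a bottom row factors \<open>\<Sum>w. \<SS>\<^sub>w w\<close> in the nilCoxeter algebra, and the Yang--Baxter equation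
  exchanges two neighbouring factors. That \<open>\<SS>\<^sub>u \<SS>\<^sub>v\<close> has a unique finite expansion holds because a
  series of positive degree in variables bounded above is zero if all \<open>\<partial>\<^sub>a\<close> annihilate it.
\<close>

subsection \<open>Power series and divided differences\<close>

text \<open>A type of its own, so that coefficient functions become a commutative ring under
  convolution.\<close>

typedef ser = "UNIV :: (int multiset \<Rightarrow> int) set" morphisms coef Ser ..

setup_lifting type_definition_ser

lemma ser_eqI: "(\<And>m. coef f m = coef g m) \<Longrightarrow> f = g"
  by transfer auto

lemma finite_msplits: "finite {(a, b). a + b = (m :: 'a multiset)}"
proof -
  have "{(a, b). a + b = m} = (\<lambda>a. (a, m - a)) ` {a. a \<subseteq># m}"
    by (auto simp: image_iff)
  moreover have "finite {a. a \<subseteq># m}"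
  proof (rule finite_subset)
    show "{a. a \<subseteq># m} \<subseteq> mset ` {xs. set xs \<subseteq> set_mset m \<and> length xs \<le> size m}"
    proof
      fix a assume "a \<in> {a. a \<subseteq># m}"
      moreover obtain xs where "mset xs = a" using ex_mset by blast
      ultimately show "a \<in> mset ` {xs. set xs \<subseteq> set_mset m \<and> length xs \<le> size m}"
        by (auto simp: image_iff size_mset_mono set_mset_mono intro!: exI[of _ xs]
            dest: set_mset_mono size_mset_mono simp flip: size_mset set_mset_mset)
    qed
    show "finite (mset ` {xs. set xs \<subseteq> set_mset m \<and> length xs \<le> size m})"
      by (intro finite_imageI finite_lists_length_le) auto
  qed
  ultimately show ?thesis by simp
qed

lemma finite_msplits' [simp]: "finite {p. fst p + snd p = (m :: 'a multiset)}"
  using finite_msplits [of m] by (simp add: case_prod_unfold)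

lemma series_mult_assoc: "series_mult (series_mult f g) h = series_mult f (series_mult g h)"
proof
  fix m
  let ?S = "\<lambda>m :: int multiset. {(a, b). a + b = m}"
  have "series_mult (series_mult f g) h m =
      (\<Sum>(p, c)\<in>?S m. \<Sum>(a, b)\<in>?S p. f a * g b * h c)"
    unfolding series_mult_def
    by (intro sum.cong refl) (auto simp: sum_distrib_right case_prod_unfold)
  also have "\<dots> = (\<Sum>(x, y)\<in>(SIGMA x:?S m. ?S (fst x)). f (fst y) * g (snd y) * h (snd x))"
    by (subst sum.Sigma [symmetric]) (auto simp: finite_msplits case_prod_unfold)
  also have "\<dots> = (\<Sum>(x, y)\<in>(SIGMA x:?S m. ?S (snd x)). f (fst x) * (g (fst y) * h (snd y)))"
    by (rule sum.reindex_bij_witness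
        [where i = "\<lambda>((a, q), (b, c)). ((a + b, c), (a, b))" and
               j = "\<lambda>((p, c), (a, b)). ((a, b + c), (b, c))"])
       (auto simp: add.assoc mult.assoc)
  also have "\<dots> = (\<Sum>(a, q)\<in>?S m. \<Sum>(b, c)\<in>?S q. f a * (g b * h c))"
    by (subst sum.Sigma [symmetric]) (auto simp: finite_msplits case_prod_unfold)
  also have "\<dots> = series_mult f (series_mult g h) m"
    unfolding series_mult_def
    by (intro sum.cong refl) (auto simp: sum_distrib_left case_prod_unfold)
  finally show "series_mult (series_mult f g) h m = series_mult f (series_mult g h) m" .
qed

lemma series_mult_commute: "series_mult f g = series_mult g f"
proof
  fix m
  show "series_mult f g m = series_mult g f m" unfolding series_mult_def
    by (rule sum.reindex_bij_witness [where i = prod.swap and j = prod.swap]) auto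
qed

lemma series_mult_supp:
  assumes "\<And>k. k \<noteq> n \<Longrightarrow> f k = 0"
  shows "series_mult f g m = (if n \<subseteq># m then f n * g (m - n) else 0)"
proof -
  have "series_mult f g m = (\<Sum>(a, b)\<in>{(a, b). a + b = m}. if a = n then f n * g (m - n) else 0)"
    unfolding series_mult_def by (intro sum.cong refl) (use assms in auto)
  also have "\<dots> = (\<Sum>x\<in>{x \<in> {(a, b). a + b = m}. fst x = n}. f n * g (m - n))"
    by (subst sum.inter_filter) (auto simp: finite_msplits case_prod_unfold)
  also have "{x \<in> {(a, b). a + b = m}. fst x = n} = (if n \<subseteq># m then {(n, m - n)} else {})"
    by auto
  finally show ?thesis by auto
qed

instantiation ser :: comm_ring_1
begin
lift_definition zero_ser :: ser is "\<lambda>_. 0" .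
lift_definition one_ser :: ser is "\<lambda>m. if m = {#} then 1 else 0" .
lift_definition plus_ser :: "ser \<Rightarrow> ser \<Rightarrow> ser" is "\<lambda>f g m. f m + g m" .
lift_definition minus_ser :: "ser \<Rightarrow> ser \<Rightarrow> ser" is "\<lambda>f g m. f m - g m" .
lift_definition uminus_ser :: "ser \<Rightarrow> ser" is "\<lambda>f m. - f m" .
lift_definition times_ser :: "ser \<Rightarrow> ser \<Rightarrow> ser" is series_mult .
instance
proof
  fix a b c :: ser
  show "a * b * c = a * (b * c)" by transfer (rule series_mult_assoc)
  show "a * b = b * a" by transfer (rule series_mult_commute)
  show "1 * a = a"
    by transfer (rule ext, subst series_mult_supp [where n = "{#}"], auto)
  show "(a + b) * c = a * c + b * c"
    by transfer (auto simp: series_mult_def case_prod_unfold sum.distrib distrib_right)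
  show "(0 :: ser) \<noteq> 1" by transfer (auto simp: fun_eq_iff)
qed (transfer; force)+
end

lemmas coef_simps [simp] = zero_ser.rep_eq one_ser.rep_eq plus_ser.rep_eq minus_ser.rep_eq
  uminus_ser.rep_eq

lift_definition X :: "int \<Rightarrow> ser" is "\<lambda>a m. if m = {#a#} then 1 else 0" .

lemma coef_X_mult: "coef (X a * f) m = (if a \<in># m then coef f (m - {#a#}) else 0)"
  by transfer (subst series_mult_supp [where n = "{#a#}" for a], auto)

lemma coef_of_int: "coef (of_int k) m = (if m = {#} then k else 0)"
proof (induction k rule: int_induct [where k = 0])
  case (step1 i) then show ?case by auto
next
  case (step2 i) then show ?case by auto
qed auto

lemma coef_of_int_mult: "coef (of_int k * f) m = k * coef f m"
proof (induction k rule: int_induct [where k = 0])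
  case (step1 i) then show ?case by (auto simp: algebra_simps)
next
  case (step2 i) then show ?case by (auto simp: algebra_simps)
qed auto

lemma coef_sum: "coef (\<Sum>x\<in>A. f x) m = (\<Sum>x\<in>A. coef (f x) m)"
  by (induction A rule: infinite_finite_induct) auto

lift_definition proj :: "(int multiset \<Rightarrow> bool) \<Rightarrow> ser \<Rightarrow> ser" is
  "\<lambda>Q f m. if Q m then f m else 0" .

section \<open>Simple reflections acting on variables and on series\<close>

lemma simple_refl_invol [simp]: "simple_refl a (simple_refl a x) = x"
  by (simp add: simple_refl_def)

lemma simple_refl_simps [simp]: "simple_refl a a = a + 1" "simple_refl a (a + 1) = a"
  by (simp_all add: simple_refl_def)

lemma simple_refl_other: "x \<noteq> a \<Longrightarrow> x \<noteq> a + 1 \<Longrightarrow> simple_refl a x = x"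
  by (simp add: simple_refl_def)

text \<open>Exchanging two variables relabels monomials by the inverse permutation;
  \<open>simple_refl a\<close> is its own inverse.\<close>

lift_definition sw :: "int \<Rightarrow> ser \<Rightarrow> ser" is "\<lambda>a f m. f (image_mset (simple_refl a) m)" .

lemma image_refl_invol [simp]: "image_mset (simple_refl a) (image_mset (simple_refl a) m) = m"
  by (simp add: multiset.map_comp comp_def)

lemma sw_mult: "sw a (f * g) = sw a f * sw a g"
proof (transfer, rule ext)
  fix a f g m
  let ?s = "image_mset (simple_refl a)"
  show "series_mult f g (?s m) = series_mult (\<lambda>m. f (?s m)) (\<lambda>m. g (?s m)) m"
    unfolding series_mult_def
    by (rule sum.reindex_bij_witness [where i = "map_prod ?s ?s" and j = "map_prod ?s ?s"])
       (auto simp flip: image_mset_union)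
qed

lemma sw_simps [simp]: "sw a (f + g) = sw a f + sw a g" "sw a (f - g) = sw a f - sw a g"
  "sw a (- f) = - sw a f" "sw a 0 = 0" "sw a 1 = 1" "sw a (sw a f) = f"
  by (transfer; auto)+

lemma sw_X: "sw a (X b) = X (simple_refl a b)"
proof (rule ser_eqI)
  fix m
  have "image_mset (simple_refl a) m = {#b#} \<longleftrightarrow> m = {#simple_refl a b#}"
    by (metis image_mset_single image_refl_invol)
  then show "coef (sw a (X b)) m = coef (X (simple_refl a b)) m"
    by (simp add: X.rep_eq sw.rep_eq)
qed

lemma refl_braid: "simple_refl a \<circ> simple_refl (a + 1) \<circ> simple_refl a =
    simple_refl (a + 1) \<circ> simple_refl a \<circ> simple_refl (a + 1)"
  by (auto simp: fun_eq_iff simple_refl_def transpose_def)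

lemma refl_commute:
  "a + 1 < b \<or> b + 1 < a \<Longrightarrow> simple_refl a \<circ> simple_refl b = simple_refl b \<circ> simple_refl a"
  by (auto simp: fun_eq_iff simple_refl_def transpose_def)

lemma sw_braid: "sw a (sw (a + 1) (sw a f)) = sw (a + 1) (sw a (sw (a + 1) f))"
  using refl_braid [of a] by transfer (simp add: multiset.map_comp comp_assoc)

lemma sw_commute: "a + 1 < b \<or> b + 1 < a \<Longrightarrow> sw a (sw b f) = sw b (sw a f)"
  by transfer (simp add: multiset.map_comp, metis refl_commute)

text \<open>\<open>X a - X (a + 1)\<close> is not a zero divisor: the equation for the difference
  \<open>h\<close> lets each coefficient trade a factor \<open>X (a + 1)\<close> for a factor
  \<open>X a\<close>, and a coefficient without \<open>X (a + 1)\<close> is 0.\<close>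

lemma diff_X_cancel:
  assumes "(X a - X (a + 1)) * f = (X a - X (a + 1)) * g"
  shows "f = g"
proof -
  define h where "h = f - g"
  have h: "(X a - X (a + 1)) * h = 0" using assms by (simp add: h_def algebra_simps)
  have eq: "coef (X a * h) m = coef (X (a + 1) * h) m" for m
    using arg_cong [OF h, of "\<lambda>f. coef f m"] by (simp add: left_diff_distrib)
  have "count m (a + 1) = k \<Longrightarrow> coef h m = 0" for k m
  proof (induction k arbitrary: m)
    case 0
    then have "a + 1 \<notin># m" by (simp add: not_in_iff)
    then show ?case using eq [of "m + {#a#}"] by (simp add: coef_X_mult)
  next
    case (Suc k)
    have mem: "a + 1 \<in># m" using Suc.prems by (simp flip: count_greater_zero_iff)
    have "coef h m = coef (X (a + 1) * h) (m + {#a#})"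
      using eq [of "m + {#a#}"] by (simp add: coef_X_mult)
    also have "\<dots> = coef h (m + {#a#} - {#a + 1#})" using mem by (simp add: coef_X_mult)
    also have "\<dots> = 0" by (rule Suc.IH) (use Suc.prems in auto)
    finally show ?case .
  qed
  then have "h = 0" by (intro ser_eqI) simp
  then show ?thesis by (simp add: h_def)
qed

lemma divided_difference_exists: "\<exists>h. (X a - X (a + 1)) * h = f - sw a f"
  \<comment> \<open>Fix the exponents of the other variables and let \<open>F p q\<close> be the coefficient of
    \<open>x\<^sub>a\<^sup>p x\<^sub>a\<^sub>+\<^sub>1\<^sup>q\<close>. The quotient has the coefficient
    \<open>h i j = (\<Sum>k\<le>i. F (n - k) k - F k (n - k))\<close> with \<open>n = i + j + 1\<close>, as found by solving
    \<open>h (i - 1) j - h i (j - 1) = F i j - F j i\<close> from \<open>i = 0\<close> upwards.\<close>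
proof -
  define F where "F r p q = coef f (filter_mset (\<lambda>x. x \<noteq> a \<and> x \<noteq> a + 1) r
    + replicate_mset p a + replicate_mset q (a + 1))" for r p q
  have F_coef: "F m (count m a) (count m (a + 1)) = coef f m" for m
    unfolding F_def by (rule arg_cong [of _ _ "coef f"]) (auto simp: multiset_eq_iff)
  have cnt: "count (image_mset (simple_refl a) m) x = count m (simple_refl a x)" for m x
  proof (induction m)
    case (add y m)
    have "x = simple_refl a y \<longleftrightarrow> simple_refl a x = y" by (metis simple_refl_invol)
    then show ?case using add by auto
  qed simp
  have F_sw: "F m (count m (a + 1)) (count m a) = coef (sw a f) m" for m
    unfolding F_def sw.rep_eq
    by (rule arg_cong [of _ _ "coef f"]) (auto simp: multiset_eq_iff cnt simple_refl_other)
  have F_cong: "F (m - {#a#}) p q = F m p q" "F (m - {#a + 1#}) p q = F m p q" for m p q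
    unfolding F_def by (rule arg_cong [of _ _ "coef f"], auto simp: multiset_eq_iff)+
  define D where "D m n k = F m (n - k) k - F m k (n - k)" for m n k
  define h where "h = Ser (\<lambda>m. \<Sum>k\<le>count m a. D m (count m a + count m (a + 1) + 1) k)"
  have coef_h: "coef h m = (\<Sum>k\<le>count m a. D m (count m a + count m (a + 1) + 1) k)" for m
    by (simp add: h_def Ser_inverse)
  have D_cong: "D (m - {#a#}) = D m" "D (m - {#a + 1#}) = D m" for m
    unfolding D_def fun_eq_iff by (simp_all add: F_cong)
  have D_sum: "(\<Sum>k\<le>n. D m n k) = 0" for m n
  proof -
    have "(\<Sum>k\<le>n. F m (n - k) k) = (\<Sum>k\<le>n. F m k (n - k))"
      by (rule sum.reindex_bij_witness [where i = "\<lambda>k. n - k" and j = "\<lambda>k. n - k"]) auto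
    then show ?thesis by (simp add: D_def sum_subtractf)
  qed
  have "coef ((X a - X (a + 1)) * h) m = coef (f - sw a f) m" for m
  proof -
    define i j where "i = count m a" and "j = count m (a + 1)"
    have rhs: "coef (f - sw a f) m = F m i j - F m j i"
      by (simp add: i_def j_def F_coef F_sw)
    have 1: "coef (X a * h) m = (\<Sum>k<i. D m (i + j) k)"
    proof (cases "i = 0")
      case True
      then have "a \<notin># m" by (simp add: i_def not_in_iff)
      then show ?thesis using True by (simp add: coef_X_mult)
    next
      case False
      then have "a \<in># m" by (simp add: i_def)
      then have "coef (X a * h) m = (\<Sum>k\<le>i - 1. D m (i + j) k)"
        using False by (simp add: coef_X_mult coef_h D_cong i_def j_def)
      also have "{..i - 1} = {..<i}" using False by auto
      finally show ?thesis .
    qed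
    have 2: "coef (X (a + 1) * h) m = (\<Sum>k\<le>i. D m (i + j) k)"
    proof (cases "j = 0")
      case True
      then have "a + 1 \<notin># m" by (simp add: j_def not_in_iff)
      then show ?thesis using True D_sum [of m i] by (simp add: coef_X_mult)
    next
      case False
      then have "a + 1 \<in># m" by (simp add: j_def)
      then show ?thesis
        using False by (simp add: coef_X_mult coef_h D_cong i_def j_def)
    qed
    have "(\<Sum>k\<le>i. D m (i + j) k) = (\<Sum>k<i. D m (i + j) k) + D m (i + j) i"
      by (simp flip: lessThan_Suc_atMost)
    then show ?thesis
      by (simp only: left_diff_distrib minus_ser.rep_eq [of "X a * h"] 1 2 rhs) (simp add: D_def)
  qed
  then show ?thesis using ser_eqI by blast
qed

text \<open>The quotient exists by \<open>divided_difference_exists\<close> and is unique by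
  \<open>diff_X_cancel\<close>.\<close>

definition dd :: "int \<Rightarrow> ser \<Rightarrow> ser" where
  "dd a f = (THE h. (X a - X (a + 1)) * h = f - sw a f)"

lemma dd_eqI: "(X a - X (a + 1)) * h = f - sw a f \<Longrightarrow> dd a f = h"
  unfolding dd_def by (rule the_equality) (auto intro: diff_X_cancel [of a])

lemma dd_mult_diff: "(X a - X (a + 1)) * dd a f = f - sw a f"
  using divided_difference_exists [of a f] dd_eqI by blast

lemma dd_add: "dd a (f + g) = dd a f + dd a g"
  by (rule dd_eqI) (simp add: distrib_left dd_mult_diff)

lemma dd_diff: "dd a (f - g) = dd a f - dd a g"
  by (rule dd_eqI) (simp add: right_diff_distrib dd_mult_diff)

lemma dd_zero [simp]: "dd a 0 = 0"
  by (rule dd_eqI) simp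

lemma sw_of_int [simp]: "sw a (of_int k) = of_int k"
  by (rule ser_eqI) (auto simp: sw.rep_eq coef_of_int)

lemma dd_mult: "dd a (f * g) = dd a f * g + sw a f * dd a g"
proof (rule dd_eqI)
  have "(X a - X (a + 1)) * (dd a f * g + sw a f * dd a g) =
      ((X a - X (a + 1)) * dd a f) * g + sw a f * ((X a - X (a + 1)) * dd a g)"
    by (simp add: algebra_simps)
  then show "(X a - X (a + 1)) * (dd a f * g + sw a f * dd a g) = f * g - sw a (f * g)"
    by (simp only: dd_mult_diff sw_mult) (simp add: algebra_simps)
qed

lemma dd_eq_0_iff: "dd a f = 0 \<longleftrightarrow> sw a f = f"
  using dd_mult_diff [of a f] by (auto intro: dd_eqI)

lemma dd_of_int_mult: "dd a (of_int k * f) = of_int k * dd a f"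
proof -
  have "dd a (of_int k) = 0" by (simp add: dd_eq_0_iff)
  then show ?thesis by (simp add: dd_mult)
qed

lemma dd_sum: "dd a (\<Sum>x\<in>A. f x) = (\<Sum>x\<in>A. dd a (f x))"
  by (induction A rule: infinite_finite_induct) (auto simp: dd_add)

lemma sw_dd [simp]: "sw a (dd a f) = dd a f"
proof (rule diff_X_cancel [of a])
  have "sw a ((X a - X (a + 1)) * dd a f) = sw a (f - sw a f)" by (simp only: dd_mult_diff)
  then have "(X (a + 1) - X a) * sw a (dd a f) = sw a f - f" by (simp add: sw_mult sw_X)
  moreover have "(X (a + 1) - X a) * sw a (dd a f) = - ((X a - X (a + 1)) * sw a (dd a f))"
    by (simp add: algebra_simps)
  ultimately show "(X a - X (a + 1)) * sw a (dd a f) = (X a - X (a + 1)) * dd a f"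
    by (simp only: dd_mult_diff) (metis minus_diff_eq minus_minus)
qed

lemma dd_dd [simp]: "dd a (dd a f) = 0"
  by (simp add: dd_eq_0_iff)

lemma sw_dd_commute:
  assumes "a + 1 < b \<or> b + 1 < a"
  shows "sw b (dd a f) = dd a (sw b f)"
proof (rule dd_eqI [symmetric])
  have "sw b ((X a - X (a + 1)) * dd a f) = sw b (f - sw a f)" by (simp only: dd_mult_diff)
  moreover have "simple_refl b a = a" "simple_refl b (a + 1) = a + 1"
    using assms by (auto simp: simple_refl_other)
  ultimately show "(X a - X (a + 1)) * sw b (dd a f) = sw b f - sw a (sw b f)"
    using sw_commute [OF assms] by (simp add: sw_mult sw_X)
qed

lemma dd_commute:
  assumes "a + 1 < b \<or> b + 1 < a"
  shows "dd a (dd b f) = dd b (dd a f)"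
proof (rule dd_eqI)
  have fix_ab: "sw b (X a - X (a + 1)) = X a - X (a + 1)"
    using assms by (auto simp: sw_X simple_refl_other)
  have "(X a - X (a + 1)) * dd b (dd a f) = dd b ((X a - X (a + 1)) * dd a f)"
    using fix_ab by (simp add: dd_mult dd_eq_0_iff [THEN iffD2])
  also have "\<dots> = dd b f - sw a (dd b f)"
    using assms by (auto simp: dd_mult_diff dd_diff sw_dd_commute)
  finally show "(X a - X (a + 1)) * dd b (dd a f) = dd b f - sw a (dd b f)" .
qed

text \<open>Multiplied by the three differences of \<open>x\<close>, \<open>y\<close>,
  \<open>z\<close>, either side becomes the alternating sum of \<open>f\<close> over the six
  permutations of these variables; the differences are then cancelled.\<close>

lemma dd_braid: "dd a (dd (a + 1) (dd a f)) = dd (a + 1) (dd a (dd (a + 1) f))"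
proof -
  define b where "b = a + 1"
  define x y z where "x = X a" and "y = X b" and "z = X (b + 1)"
  have sa [simp]: "sw a x = y" "sw a y = x" "sw a z = z"
    and sb [simp]: "sw b x = x" "sw b y = z" "sw b z = y"
    by (auto simp: x_def y_def z_def b_def sw_X simple_refl_def)
  have A: "(x - y) * dd a g = g - sw a g" for g
    using dd_mult_diff [of a g] by (simp add: x_def y_def b_def)
  have B: "(y - z) * dd b g = g - sw b g" for g
    using dd_mult_diff [of b g] by (simp add: y_def z_def)
  have braid: "sw a (sw b (sw a f)) = sw b (sw a (sw b f))"
    unfolding b_def by (rule sw_braid)
  have 1: "(x - y) * ((y - z) * ((x - z) * dd a (dd b (dd a f)))) =
      f - sw a f - sw b f + sw b (sw a f) + sw a (sw b f) - sw a (sw b (sw a f))"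
  proof -
    define h k where "h = dd a f" and "k = dd b h"
    have h: "(x - y) * h = f - sw a f" and k: "(y - z) * k = h - sw b h"
      by (simp_all add: h_def k_def A B)
    have h1: "(x - z) * sw b h = sw b f - sw b (sw a f)"
      using arg_cong [OF h, of "sw b"] by (simp add: sw_mult)
    have h2: "(y - z) * sw a (sw b h) = sw a (sw b f) - sw a (sw b (sw a f))"
      using arg_cong [OF h1, of "sw a"] by (simp add: sw_mult)
    have k1: "(x - z) * sw a k = h - sw a (sw b h)"
      using arg_cong [OF k, of "sw a"] by (simp add: sw_mult h_def)
    have "(x - y) * ((y - z) * ((x - z) * dd a k)) = (y - z) * ((x - z) * ((x - y) * dd a k))"
      by (simp add: algebra_simps)
    also have "\<dots> = (x - z) * ((y - z) * k) - (y - z) * ((x - z) * sw a k)"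
      by (simp only: A) (simp add: algebra_simps)
    also have "\<dots> = (x - y) * h - (x - z) * sw b h + (y - z) * sw a (sw b h)"
      by (simp only: k k1) (simp add: algebra_simps)
    finally show ?thesis by (simp only: h h1 h2) (simp add: h_def k_def)
  qed
  have 2: "(x - y) * ((y - z) * ((x - z) * dd b (dd a (dd b f)))) =
      f - sw a f - sw b f + sw b (sw a f) + sw a (sw b f) - sw a (sw b (sw a f))"
  proof -
    define h k where "h = dd b f" and "k = dd a h"
    have h: "(y - z) * h = f - sw b f" and k: "(x - y) * k = h - sw a h"
      by (simp_all add: h_def k_def A B)
    have h1: "(x - z) * sw a h = sw a f - sw a (sw b f)"
      using arg_cong [OF h, of "sw a"] by (simp add: sw_mult)
    have h2: "(x - y) * sw b (sw a h) = sw b (sw a f) - sw b (sw a (sw b f))"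
      using arg_cong [OF h1, of "sw b"] by (simp add: sw_mult)
    have k1: "(x - z) * sw b k = h - sw b (sw a h)"
      using arg_cong [OF k, of "sw b"] by (simp add: sw_mult h_def)
    have "(x - y) * ((y - z) * ((x - z) * dd b k)) = (x - y) * ((x - z) * ((y - z) * dd b k))"
      by (simp add: algebra_simps)
    also have "\<dots> = (x - z) * ((x - y) * k) - (x - y) * ((x - z) * sw b k)"
      by (simp only: B) (simp add: algebra_simps)
    also have "\<dots> = (y - z) * h - (x - z) * sw a h + (x - y) * sw b (sw a h)"
      by (simp only: k k1) (simp add: algebra_simps)
    finally show ?thesis by (simp only: h h1 h2) (simp add: h_def k_def braid)
  qed
  let ?L = "dd a (dd b (dd a f))" and ?R = "dd b (dd a (dd b f))"
  have "(x - y) * ((y - z) * ((x - z) * ?L)) = (x - y) * ((y - z) * ((x - z) * ?R))"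
    by (simp only: 1 2)
  then have "(y - z) * ((x - z) * ?L) = (y - z) * ((x - z) * ?R)"
    using diff_X_cancel [of a] unfolding x_def y_def b_def by blast
  then have "(x - z) * ?L = (x - z) * ?R"
    using diff_X_cancel [of b] unfolding y_def z_def by blast
  \<comment> \<open>\<open>diff_X_cancel\<close> covers only neighbouring variables;
    \<open>sw b\<close> turns \<open>x - z\<close> into \<open>x - y\<close>.\<close>
  then have "sw b ((x - z) * ?L) = sw b ((x - z) * ?R)" by simp
  then have "(x - y) * sw b ?L = (x - y) * sw b ?R" by (simp only: sw_mult) simp
  then have "sw b ?L = sw b ?R"
    using diff_X_cancel [of a] unfolding x_def y_def b_def by blast
  then have "?L = ?R" by (metis sw_simps(6))
  then show ?thesis by (simp add: b_def)
qed

text \<open>Projecting the defining equation of \<open>dd a f\<close> by \<open>Q\<close> shows that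
  \<open>proj Q' (dd a f)\<close> solves it as well, so uniqueness gives the claim. This controls
  degrees and variables of divided differences.\<close>

lemma dd_support:
  assumes f: "\<And>m. coef f m \<noteq> 0 \<Longrightarrow> Q m"
    and Q: "\<And>m. Q (image_mset (simple_refl a) m) = Q m"
      "\<And>m. Q (add_mset a m) = Q' m" "\<And>m. Q (add_mset (a + 1) m) = Q' m"
    and "coef (dd a f) m \<noteq> 0"
  shows "Q' m"
proof -
  have X_proj: "X c * proj Q' h = proj Q (X c * h)" if "c = a \<or> c = a + 1" for c h
  proof (rule ser_eqI)
    fix m
    show "coef (X c * proj Q' h) m = coef (proj Q (X c * h)) m"
      using that Q(2-3) [of "m - {#c#}"] by (auto simp: coef_X_mult proj.rep_eq)
  qed
  have proj_f: "proj Q f = f"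
    by (rule ser_eqI) (use f in \<open>auto simp: proj.rep_eq\<close>)
  moreover have "proj Q (sw a f) = sw a (proj Q f)"
    by (rule ser_eqI) (simp add: proj.rep_eq sw.rep_eq Q)
  moreover have "proj Q (g - h) = proj Q g - proj Q h" for g h
    by (rule ser_eqI) (simp add: proj.rep_eq)
  ultimately have "(X a - X (a + 1)) * proj Q' (dd a f) = f - sw a f"
    using dd_mult_diff [of a f] by (metis X_proj left_diff_distrib)
  then have "dd a f = proj Q' (dd a f)" by (rule dd_eqI)
  with assms(5) show ?thesis by (metis proj.rep_eq)
qed

text \<open>Compare coefficients of the power \<open>Suc d\<close> of \<open>X a\<close> in
  \<open>dd_mult_diff\<close>; the multiple of \<open>X (a + 1)\<close> contributes nothing
  there.\<close>

lemma coef_dd_power: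
  "coef (dd a f) (replicate_mset d a) =
    coef f (replicate_mset (Suc d) a) - coef f (replicate_mset (Suc d) (a + 1))"
proof -
  have "coef (X a * dd a f) (replicate_mset (Suc d) a)
      - coef (X (a + 1) * dd a f) (replicate_mset (Suc d) a) =
    coef f (replicate_mset (Suc d) a) - coef (sw a f) (replicate_mset (Suc d) a)"
    by (metis dd_mult_diff left_diff_distrib minus_ser.rep_eq)
  moreover have "a + 1 \<notin># replicate_mset (Suc d) a" by (auto split: if_splits)
  ultimately show ?thesis by (simp add: coef_X_mult sw.rep_eq)
qed

subsection \<open>Permutations and reduced words\<close>

lemma S_Z_bounds:
  assumes "w \<in> S_Z"
  obtains l h where "\<And>i. i < l \<Longrightarrow> w i = i" "\<And>i. h < i \<Longrightarrow> w i = i"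
proof -
  let ?A = "{i. w i \<noteq> i}"
  have fin: "finite ?A" using assms by (simp add: S_Z_def)
  then obtain l where l: "\<And>i. i \<in> ?A \<Longrightarrow> l \<le> i"
    using bdd_below_finite [of ?A] by (auto simp: bdd_below_def)
  obtain h where h: "\<And>i. i \<in> ?A \<Longrightarrow> i \<le> h"
    using bdd_above_finite [OF fin] by (auto simp: bdd_above_def)
  show ?thesis by (rule that [of l h]) (use l h in \<open>force+\<close>)
qed

lemma simple_refl_in_S_Z: "simple_refl a \<in> S_Z"
proof -
  have "{i. simple_refl a i \<noteq> i} \<subseteq> {a, a + 1}" using simple_refl_other by auto
  then have "finite {i. simple_refl a i \<noteq> i}" by (rule finite_subset) auto
  moreover have "bij (simple_refl a)" by (simp add: simple_refl_def)
  ultimately show ?thesis by (simp add: S_Z_def)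
qed

lemma S_Z_comp:
  assumes "v \<in> S_Z" "w \<in> S_Z"
  shows "v \<circ> w \<in> S_Z"
proof -
  have "{i. (v \<circ> w) i \<noteq> i} \<subseteq> {i. v i \<noteq> i} \<union> {i. w i \<noteq> i}" by auto
  then have "finite {i. (v \<circ> w) i \<noteq> i}"
    by (rule finite_subset) (use assms in \<open>auto simp: S_Z_def\<close>)
  then show ?thesis using assms by (auto simp: S_Z_def intro: bij_comp)
qed

lemma comp_refl_refl [simp]: "w \<circ> simple_refl a \<circ> simple_refl a = w"
  by (simp add: fun_eq_iff)

lemma S_Z_comp_refl [simp]: "w \<circ> simple_refl a \<in> S_Z \<longleftrightarrow> w \<in> S_Z"
  by (metis S_Z_comp comp_refl_refl simple_refl_in_S_Z)

lemma comp_refl_eq_iff: "v \<circ> simple_refl a = w \<longleftrightarrow> v = w \<circ> simple_refl a"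
  by (metis comp_refl_refl)

lemma S_Z_eq_iff: "w \<in> S_Z \<Longrightarrow> w i = w j \<longleftrightarrow> i = j"
  by (auto simp: S_Z_def bij_def dest: injD)

lemma S_Z_not_descent: "w \<in> S_Z \<Longrightarrow> \<not> w a > w (a + 1) \<longleftrightarrow> w a < w (a + 1)"
  using S_Z_eq_iff [of w a "a + 1"] by auto

text \<open>Their number is the Coxeter length; see \<open>RW_iff\<close>.\<close>

definition inversions :: "(int \<Rightarrow> int) \<Rightarrow> (int \<times> int) set" where
  "inversions w = {(i, j). i < j \<and> w j < w i}"

lemma finite_inversions:
  assumes "w \<in> S_Z"
  shows "finite (inversions w)"
proof -
  obtain l h where l: "\<And>i. i < l \<Longrightarrow> w i = i" and h: "\<And>i. h < i \<Longrightarrow> w i = i"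
    using S_Z_bounds [OF assms] by metis
  have lo: "l \<le> w i" if "l \<le> i" for i
    using l [of "w i"] S_Z_eq_iff [OF assms, of "w i" i] that by force
  have hi: "w i \<le> h" if "i \<le> h" for i
    using h [of "w i"] S_Z_eq_iff [OF assms, of "w i" i] that by force
  have "inversions w \<subseteq> {l..h} \<times> {l..h}"
  proof (clarsimp simp: inversions_def)
    fix i j assume ij: "i < j" "w j < w i"
    have "l \<le> i" using l [of i] l [of j] lo [of j] ij by force
    moreover have "j \<le> h" using h [of i] h [of j] hi [of i] ij by force
    ultimately show "l \<le> i \<and> i \<le> h \<and> l \<le> j \<and> j \<le> h" using ij by auto
  qed
  then show ?thesis by (rule finite_subset) auto
qed

text \<open>The reflection keeps the order of every pair except \<open>(a, a + 1)\<close>, so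
  applying it to both entries matches the other inversions of \<open>w\<close> with those of
  \<open>w \<circ> simple_refl a\<close>.\<close>

lemma card_inversions_descent:
  assumes "w \<in> S_Z" "w (a + 1) < w a"
  shows "card (inversions w) = Suc (card (inversions (w \<circ> simple_refl a)))"
proof -
  let ?s = "map_prod (simple_refl a) (simple_refl a)"
  have mono: "simple_refl a i < simple_refl a j" if "i < j" "(i, j) \<noteq> (a, a + 1)" for i j
    using that by (auto simp: simple_refl_def transpose_def)
  have "bij_betw ?s (inversions w - {(a, a + 1)}) (inversions (w \<circ> simple_refl a))"
  proof (rule bij_betw_byWitness [where f' = ?s])
    show "?s ` (inversions w - {(a, a + 1)}) \<subseteq> inversions (w \<circ> simple_refl a)"
      using mono by (auto simp: inversions_def)
    show "?s ` inversions (w \<circ> simple_refl a) \<subseteq> inversions w - {(a, a + 1)}"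
    proof (clarsimp simp: inversions_def)
      fix i j assume ij: "i < j" "w (simple_refl a j) < w (simple_refl a i)"
      have "(i, j) \<noteq> (a, a + 1)" using ij assms(2) by auto
      then show "simple_refl a i < simple_refl a j \<and>
          (simple_refl a i = a \<longrightarrow> simple_refl a j \<noteq> a + 1)"
        using mono [OF ij(1)] ij(1) by (metis less_asym simple_refl_invol simple_refl_simps)
    qed
  qed auto
  then have "card (inversions w - {(a, a + 1)}) = card (inversions (w \<circ> simple_refl a))"
    by (rule bij_betw_same_card)
  moreover have "(a, a + 1) \<in> inversions w" using assms by (simp add: inversions_def)
  ultimately show ?thesis
    using finite_inversions [OF assms(1)] by (metis card_Suc_Diff1)
qed

lemma card_inversions_ascent:
  assumes "w \<in> S_Z" "w a < w (a + 1)"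
  shows "card (inversions (w \<circ> simple_refl a)) = Suc (card (inversions w))"
  using card_inversions_descent [of "w \<circ> simple_refl a" a] assms by simp

text \<open>Without descents \<open>w\<close> is strictly increasing, so
  \<open>w j - w k \<ge> j - k\<close> for \<open>k \<le> j\<close>. Comparing \<open>i\<close> with
  fixed points far below and far above pins \<open>w i\<close> to \<open>i\<close>.\<close>

lemma S_Z_no_descent:
  assumes "w \<in> S_Z" "\<And>a. \<not> w (a + 1) < w a"
  shows "w = id"
proof
  fix i
  obtain l h where l: "\<And>i. i < l \<Longrightarrow> w i = i" and h: "\<And>i. h < i \<Longrightarrow> w i = i"
    using S_Z_bounds [OF assms(1)] by metis
  have step: "w a < w (a + 1)" for a
    using assms S_Z_not_descent by blast
  have shift: "w (k + int n) \<ge> w k + int n" for k n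
  proof (induction n)
    case (Suc n)
    then show ?case using step [of "k + int n"] by (simp add: algebra_simps)
  qed simp
  have step': "w j - w k \<ge> j - k" if "k \<le> j" for j k
    using shift [of k "nat (j - k)"] that by simp
  have "w i \<ge> i" using step' [of "min i (l - 1)" i] l [of "min i (l - 1)"] by auto
  moreover have "w i \<le> i" using step' [of i "max i (h + 1)"] h [of "max i (h + 1)"] by auto
  ultimately show "w i = id i" by simp
qed

lemma card_inversions_id [simp]: "card (inversions id) = 0"
proof -
  have "inversions id = {}" by (auto simp: inversions_def)
  then show ?thesis by simp
qed

lemma id_in_S_Z [simp]: "id \<in> S_Z"
  by (simp add: S_Z_def)

lemma S_Z_induct [consumes 1, case_names id descent]:
  assumes "w \<in> S_Z" and "P id"
    and "\<And>w a. w \<in> S_Z \<Longrightarrow> w (a + 1) < w a \<Longrightarrow> P (w \<circ> simple_refl a) \<Longrightarrow> P w"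
  shows "P w"
  using assms(1)
proof (induction "card (inversions w)" arbitrary: w rule: less_induct)
  case less
  show ?case
  proof (cases "w = id")
    case False
    then obtain a where "w (a + 1) < w a" using S_Z_no_descent less.prems by blast
    then show ?thesis
      using less assms(3) [of w a] card_inversions_descent [of w a] by simp
  qed (use assms(2) in simp)
qed

section \<open>Reduced words\<close>

lemma word_perm_Nil: "word_perm [] = id"
  by (simp add: word_perm_def)

lemma word_perm_append: "word_perm (s @ t) = word_perm s \<circ> word_perm t"
  by (induction s) (auto simp: word_perm_def)

lemma word_perm_snoc: "word_perm (t @ [a]) = word_perm t \<circ> simple_refl a"
  by (simp add: word_perm_append) (simp add: word_perm_def)

lemma word_perm_in_S_Z [simp]: "word_perm t \<in> S_Z"
proof (induction t rule: rev_induct)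
  case Nil
  show ?case unfolding word_perm_Nil by (rule id_in_S_Z)
next
  case (snoc a t)
  then show ?case unfolding word_perm_snoc by (simp only: S_Z_comp_refl)
qed

lemma card_inversions_le_length: "card (inversions (word_perm t)) \<le> length t"
proof (induction t rule: rev_induct)
  case (snoc a t)
  then have "card (inversions (word_perm t \<circ> simple_refl a)) \<le> length (t @ [a])"
    using card_inversions_ascent [of "word_perm t" a] card_inversions_descent [of "word_perm t" a]
      S_Z_not_descent [of "word_perm t" a]
    by (cases "word_perm t a < word_perm t (a + 1)") simp_all
  then show ?case by (simp only: word_perm_snoc)
qed (simp only: word_perm_Nil card_inversions_id le0)

lemma reduced_word_exists:
  assumes "w \<in> S_Z"
  shows "\<exists>t. word_perm t = w \<and> length t = card (inversions w)"
  using assms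
proof (induction w rule: S_Z_induct)
  case (descent w a)
  then obtain t where "word_perm t = w \<circ> simple_refl a"
    "length t = card (inversions (w \<circ> simple_refl a))" by blast
  then show ?case using descent card_inversions_descent
    by (intro exI [of _ "t @ [a]"]) (simp add: word_perm_snoc)
next
  case id
  show ?case by (rule exI [of _ "[]"]) (simp only: word_perm_Nil card_inversions_id list.size)
qed

lemma RW_iff:
  assumes "w \<in> S_Z"
  shows "t \<in> RW w \<longleftrightarrow> word_perm t = w \<and> length t = card (inversions w)"
proof -
  obtain r where "word_perm r = w" "length r = card (inversions w)"
    using reduced_word_exists [OF assms] by blast
  then show ?thesis
    using card_inversions_le_length le_antisym unfolding RW_def mem_Collect_eq by metis
qed

lemma RW_not_empty: "w \<in> S_Z \<Longrightarrow> RW w \<noteq> {}"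
  using reduced_word_exists RW_iff by blast

text \<open>The recursion behind all later inductions over reduced words. If \<open>a\<close> were
  an ascent, \<open>t\<close> would have fewer letters than its permutation has inversions.\<close>

lemma RW_snoc:
  assumes "w \<in> S_Z"
  shows "t @ [a] \<in> RW w \<longleftrightarrow> w (a + 1) < w a \<and> t \<in> RW (w \<circ> simple_refl a)"
proof (cases "w (a + 1) < w a")
  case True
  then show ?thesis
    using assms card_inversions_descent [OF assms True] by (simp add: RW_iff word_perm_snoc comp_refl_eq_iff)
next
  case False
  then have "card (inversions (w \<circ> simple_refl a)) = Suc (card (inversions w))"
    using assms S_Z_not_descent card_inversions_ascent by blast
  then have "t @ [a] \<notin> RW w"
    using assms card_inversions_le_length [of t] by (auto simp: RW_iff word_perm_snoc comp_refl_eq_iff)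
  with False show ?thesis by simp
qed

lemma finite_descents:
  assumes "w \<in> S_Z"
  shows "finite {a. w (a + 1) < w a}"
proof -
  have "(\<lambda>a. (a, a + 1)) ` {a. w (a + 1) < w a} \<subseteq> inversions w" by (auto simp: inversions_def)
  then have "finite ((\<lambda>a. (a, a + 1)) ` {a. w (a + 1) < w a})"
    using finite_inversions [OF assms] finite_subset by blast
  then show ?thesis by (rule finite_imageD) (auto simp: inj_on_def)
qed

lemma finite_RW:
  assumes "w \<in> S_Z"
  shows "finite (RW w)"
  using assms
proof (induction "card (inversions w)" arbitrary: w)
  case 0
  then have "RW w \<subseteq> {[]}" by (auto simp: RW_iff)
  then show ?case using finite_subset by blast
next
  case (Suc n)
  have "RW w \<subseteq> (\<Union>a\<in>{a. w (a + 1) < w a}. (\<lambda>t. t @ [a]) ` RW (w \<circ> simple_refl a))"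
  proof
    fix t assume t: "t \<in> RW w"
    then have "t \<noteq> []" using Suc by (auto simp: RW_iff)
    then obtain s a where "t = s @ [a]" by (metis rev_exhaust)
    then show "t \<in> (\<Union>a\<in>{a. w (a + 1) < w a}. (\<lambda>t. t @ [a]) ` RW (w \<circ> simple_refl a))"
      using t RW_snoc [OF Suc.prems] by auto
  qed
  moreover have "finite (RW (w \<circ> simple_refl a))" if "w (a + 1) < w a" for a
    using Suc card_inversions_descent [OF _ that] by simp
  ultimately show ?case
    using finite_descents [OF Suc.prems] by (auto intro: finite_subset)
qed

subsection \<open>Divided differences of back-stable Schubert series\<close>

text \<open>Right multiplication in the nilCoxeter algebra: a function \<open>F\<close> on permutations stands for
  \<open>\<Sum>w. F w \<cdot> w\<close>. Then \<open>uop a\<close> is multiplication by the generator \<open>u\<^sub>a\<close>, \<open>hop x a\<close>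
  by \<open>1 + x u\<^sub>a\<close>, and \<open>Aop N k x\<close> by
  \<open>(1 + x u\<^sub>N\<^sub>-\<^sub>1) (1 + x u\<^sub>N\<^sub>-\<^sub>2) \<cdots> (1 + x u\<^sub>N\<^sub>-\<^sub>k)\<close>.\<close>

definition uop :: "int \<Rightarrow> ((int \<Rightarrow> int) \<Rightarrow> 'r) \<Rightarrow> (int \<Rightarrow> int) \<Rightarrow> 'r::comm_ring_1" where
  "uop a F w = (if w (a + 1) < w a then F (w \<circ> simple_refl a) else 0)"

definition hop :: "'r \<Rightarrow> int \<Rightarrow> ((int \<Rightarrow> int) \<Rightarrow> 'r) \<Rightarrow> (int \<Rightarrow> int) \<Rightarrow> 'r::comm_ring_1" where
  "hop x a F w = F w + x * uop a F w"

primrec Aop :: "int \<Rightarrow> nat \<Rightarrow> 'r \<Rightarrow> ((int \<Rightarrow> int) \<Rightarrow> 'r) \<Rightarrow> (int \<Rightarrow> int) \<Rightarrow> 'r::comm_ring_1" where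
  "Aop N 0 x F = F"
| "Aop N (Suc k) x F = hop x (N - int (Suc k)) (Aop N k x F)"

lemma uop_hop: "uop a (hop x b F) w = uop a F w + x * uop a (uop b F) w"
  by (simp add: uop_def hop_def)

lemma uop_uop [simp]: "uop a (uop a F) w = 0"
  by (simp add: uop_def)

lemma uop_commute:
  assumes "a + 1 < b \<or> b + 1 < a"
  shows "uop a (uop b F) w = uop b (uop a F) w"
proof -
  have "simple_refl a b = b" "simple_refl a (b + 1) = b + 1"
    "simple_refl b a = a" "simple_refl b (a + 1) = a + 1"
    using assms by (auto simp: simple_refl_other)
  moreover have "w \<circ> simple_refl a \<circ> simple_refl b = w \<circ> simple_refl b \<circ> simple_refl a"
    using refl_commute [OF assms] by (simp add: comp_assoc)
  ultimately show ?thesis by (simp add: uop_def)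
qed

text \<open>Either side can be nonzero only if \<open>w\<close> decreases along \<open>a\<close>,
  \<open>a + 1\<close>, \<open>a + 2\<close>, and then both evaluate \<open>F\<close> at the same
  permutation.\<close>

lemma uop_braid: "uop a (uop (a + 1) (uop a F)) w = uop (a + 1) (uop a (uop (a + 1) F)) w"
proof -
  have "w \<circ> simple_refl a \<circ> simple_refl (a + 1) \<circ> simple_refl a =
      w \<circ> simple_refl (a + 1) \<circ> simple_refl a \<circ> simple_refl (a + 1)"
    using refl_braid [of a] by (simp add: comp_assoc)
  then show ?thesis by (auto simp: uop_def simple_refl_def transpose_def)
qed

text \<open>The middle parameter is the sum of the outer two. After expansion, squares of a
  generator vanish and the cubic terms agree by \<open>uop_braid\<close>.\<close>

lemma yang_baxter:
  "hop (y - x) a (hop y (a + 1) (hop x a F)) = hop x (a + 1) (hop y a (hop (y - x) (a + 1) F))"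
proof
  fix w
  define b where "b = a + 1"
  have uop3: "uop c (uop d (hop z e G)) w = uop c (uop d G) w + z * uop c (uop d (uop e G)) w"
    for c d e z G
    by (simp add: uop_def hop_def)
  have braid: "uop a (uop b (uop a F)) w = uop b (uop a (uop b F)) w"
    unfolding b_def by (rule uop_braid)
  have "hop (y - x) a (hop y b (hop x a F)) w = hop x b (hop y a (hop (y - x) b F)) w"
    by (simp add: uop_hop uop3 braid hop_def [of _ _ _ w]) (simp add: algebra_simps)
  then show "hop (y - x) a (hop y (a + 1) (hop x a F)) w =
      hop x (a + 1) (hop y a (hop (y - x) (a + 1) F)) w"
    by (simp add: b_def)
qed

lemma hop_commute:
  assumes "a + 1 < b \<or> b + 1 < a"
  shows "hop x a (hop y b F) = hop y b (hop x a F)"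
proof
  fix w
  show "hop x a (hop y b F) w = hop y b (hop x a F) w"
    using uop_commute [OF assms, of F w]
    by (simp add: uop_hop hop_def [of _ _ _ w]) (simp add: algebra_simps)
qed

lemma hop_Aop_commute:
  assumes "a + 1 < N - int k"
  shows "hop z a (Aop N k x F) = Aop N k x (hop z a F)"
  using assms by (induction k) (simp_all add: hop_commute [of a])

text \<open>One extra factor exchanges the parameters of two neighbouring products. The base case is
  (1 + x u) (1 + (y - x) u) = 1 + y u, as u squares to 0. In the step, \<open>yang_baxter\<close>
  turns the extra factor at \<open>a\<close> into one at \<open>a + 1\<close>, to which the
  induction hypothesis applies.\<close>

lemma Aop_swap:
  "hop (y - x) (N - int (Suc k)) (Aop N k y (Aop N (Suc k) x F)) = Aop N k x (Aop N (Suc k) y F)"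
proof (induction k)
  case 0
  have "hop (y - x) (N - 1) (hop x (N - 1) F) w = hop y (N - 1) F w" for w
  proof -
    have "hop (y - x) (N - 1) (hop x (N - 1) F) w =
        hop x (N - 1) F w + (y - x) * uop (N - 1) F w"
      unfolding hop_def [of "y - x"] by (simp add: uop_hop)
    then show ?thesis by (simp add: hop_def algebra_simps)
  qed
  then show ?case by (simp add: fun_eq_iff)
next
  case (Suc k)
  define a where "a = N - int (Suc (Suc k))"
  have a1: "N - int (Suc k) = a + 1" and a2: "a + 1 < N - int k" by (simp_all add: a_def)
  have IH: "hop (y - x) (a + 1) (Aop N k y (Aop N (Suc k) x F)) =
      Aop N k x (Aop N (Suc k) y F)"
    using Suc.IH by (simp only: a1)
  have expand: "Aop N (Suc k) x' (Aop N (Suc (Suc k)) y' F) =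
      hop x' (a + 1) (hop y' a (Aop N k x' (Aop N (Suc k) y' F)))" for x' y'
    unfolding Aop.simps(2) [of N "Suc k"] Aop.simps(2) [of N k x'] a1 a_def [symmetric]
    by (simp only: hop_Aop_commute [OF a2])
  show ?case
    unfolding expand a_def [symmetric] yang_baxter IH ..
qed

text \<open>All descents of such permutations lie below \<open>N\<close>, which makes the products
  of Fomin and Stanley finite. Removing a descent stays in this set, so families are compared only
  on it.\<close>

definition fixes_above :: "int \<Rightarrow> (int \<Rightarrow> int) set" where
  "fixes_above N = {w \<in> S_Z. \<forall>i>N. w i = i}"

lemma fixes_above_descent:
  assumes "w \<in> fixes_above N" "w (a + 1) < w a"
  shows "a < N" "w \<circ> simple_refl a \<in> fixes_above N"
proof -
  have w: "w \<in> S_Z" and fix_N: "\<And>i. N < i \<Longrightarrow> w i = i"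
    using assms(1) by (auto simp: fixes_above_def)
  show "a < N"
  proof (rule ccontr)
    assume "\<not> a < N"
    then have "w (a + 1) = a + 1" by (simp add: fix_N)
    then have "N < w a" "a < w a" using assms(2) \<open>\<not> a < N\<close> by auto
    then show False using fix_N [of "w a"] S_Z_eq_iff [OF w, of "w a" a] by simp
  qed
  then show "w \<circ> simple_refl a \<in> fixes_above N"
    using w fix_N by (auto simp: fixes_above_def simple_refl_other)
qed

lemma S_Z_fixes_above:
  assumes "w \<in> S_Z"
  obtains N where "w \<in> fixes_above N" "N \<ge> M"
proof -
  obtain l h where "\<And>i. i < l \<Longrightarrow> w i = i" and h: "\<And>i. h < i \<Longrightarrow> w i = i"
    using S_Z_bounds [OF assms] by metis
  show ?thesis by (rule that [of "max h M"]) (use assms h in \<open>auto simp: fixes_above_def\<close>)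
qed

lemma hop_cong:
  assumes "w \<in> fixes_above N" "\<And>w. w \<in> fixes_above N \<Longrightarrow> F w = G w"
  shows "hop x a F w = hop x a G w"
  using assms fixes_above_descent by (auto simp: hop_def uop_def)

lemma Aop_cong:
  assumes "w \<in> fixes_above N" "\<And>w. w \<in> fixes_above N \<Longrightarrow> F w = G w"
  shows "Aop M k x F w = Aop M k x G w"
  using assms(1)
proof (induction k arbitrary: w)
  case (Suc k)
  then show ?case unfolding Aop.simps by (intro hop_cong)
qed (use assms(2) in simp)

lemma RW_letters_less:
  assumes "w \<in> fixes_above N" "t \<in> RW w" "a \<in> set t"
  shows "a < N"
  using assms
proof (induction t arbitrary: w rule: rev_induct)
  case (snoc c t)
  have w: "w \<in> S_Z" using snoc.prems(1) by (simp add: fixes_above_def)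
  have c: "w (c + 1) < w c" and t: "t \<in> RW (w \<circ> simple_refl c)"
    using snoc.prems(2) RW_snoc [OF w, of t c] by blast+
  show ?case
  proof (cases "a = c")
    case False
    then have "a \<in> set t" using snoc.prems(3) by simp
    then show ?thesis
      by (rule snoc.IH [OF fixes_above_descent(2) [OF snoc.prems(1) c] t])
  qed (use fixes_above_descent(1) [OF snoc.prems(1) c] in simp)
qed simp

section \<open>Reduced words with bottom rows, counted block by block\<close>

definition Sch :: "(int \<Rightarrow> int) \<Rightarrow> ser" where
  "Sch w = Ser (back_stable_schubert w)"

text \<open>The entries of a bottom row equal to the maximal value \<open>j\<close> form a suffix, over which the
  reduced word is strictly decreasing. Lowering the bound \<open>c\<close> on its last letter one step at a
  time builds this suffix letter by letter.\<close>

definition compatible_pairs ::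
    "int \<Rightarrow> int \<Rightarrow> (int \<Rightarrow> int) \<Rightarrow> int multiset \<Rightarrow> (int list \<times> int list) set" where
  "compatible_pairs j c w m = {(t, b). t \<in> RW w \<and> bottom_row t b \<and> mset b = m \<and>
     (\<forall>x\<in>#m. x \<le> j) \<and> (b \<noteq> [] \<and> last b = j \<longrightarrow> c \<le> last t)}"

lemma finite_mset_lists: "finite {b. mset b = m}"
proof (rule finite_subset)
  show "{b. mset b = m} \<subseteq> {b. set b \<subseteq> set_mset m \<and> length b \<le> size m}" by auto
  show "finite {b. set b \<subseteq> set_mset m \<and> length b \<le> size m}"
    by (rule finite_lists_length_le) simp
qed

lemma finite_bottom_rows: "finite {b. bottom_row t b \<and> mset b = m}"
  by (rule finite_subset [OF _ finite_mset_lists [of m]]) auto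

lemma finite_compatible_pairs:
  assumes "w \<in> S_Z"
  shows "finite (compatible_pairs j c w m)"
  by (rule finite_subset [of _ "RW w \<times> {b. mset b = m}"])
     (auto simp: compatible_pairs_def finite_RW [OF assms] finite_mset_lists)

lemma coef_Sch:
  assumes "w \<in> S_Z"
  shows "coef (Sch w) m = int (card {(t, b). t \<in> RW w \<and> bottom_row t b \<and> mset b = m})"
proof -
  have "{(t, b). t \<in> RW w \<and> bottom_row t b \<and> mset b = m} =
      (SIGMA t:RW w. {b. bottom_row t b \<and> mset b = m})" by auto
  then show ?thesis
    using finite_RW [OF assms]
    by (simp add: Sch_def Ser_inverse back_stable_schubert_def finite_bottom_rows)
qed

lemma bottom_row_snoc:
  assumes "length b = length t"
  shows "bottom_row (t @ [c]) (b @ [j]) \<longleftrightarrow> bottom_row t b \<and> j \<le> c \<and>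
    (b \<noteq> [] \<longrightarrow> last b \<le> j \<and> (last t < c \<longrightarrow> last b < j))"
proof -
  have 1: "sorted (b @ [j]) \<longleftrightarrow> sorted b \<and> (b \<noteq> [] \<longrightarrow> last b \<le> j)"
    by (cases b rule: rev_cases) (auto simp: sorted_append)
  have 2: "(\<forall>k<length (t @ [c]). (b @ [j]) ! k \<le> (t @ [c]) ! k) \<longleftrightarrow>
      (\<forall>k<length t. b ! k \<le> t ! k) \<and> j \<le> c"
    using assms by (auto simp: nth_append less_Suc_eq)
  have 3: "(\<forall>k. Suc k < length (t @ [c]) \<and> (t @ [c]) ! k < (t @ [c]) ! Suc k \<longrightarrow>
        (b @ [j]) ! k < (b @ [j]) ! Suc k) \<longleftrightarrow>
      (\<forall>k. Suc k < length t \<and> t ! k < t ! Suc k \<longrightarrow> b ! k < b ! Suc k) \<and>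
      (b \<noteq> [] \<longrightarrow> last t < c \<longrightarrow> last b < j)"
  proof (cases t rule: rev_cases)
    case Nil
    then show ?thesis using assms by simp
  next
    case (snoc t' d)
    then obtain b' e where b: "b = b' @ [e]" using assms by (cases b rule: rev_cases) auto
    have len: "length b' = length t'" using assms snoc b by simp
    let ?P = "\<lambda>t b k. t ! k < t ! Suc k \<longrightarrow> b ! k < (b :: int list) ! Suc k"
    have "(\<forall>k. Suc k < length (t @ [c]) \<longrightarrow> ?P (t @ [c]) (b @ [j]) k) \<longleftrightarrow>
        (\<forall>k. Suc k < length t \<longrightarrow> ?P (t @ [c]) (b @ [j]) k) \<and> ?P (t @ [c]) (b @ [j]) (length t')"
      using snoc by (auto simp: less_Suc_eq)
    also have "?P (t @ [c]) (b @ [j]) (length t') \<longleftrightarrow> (last t < c \<longrightarrow> last b < j)"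
      using snoc b len by (simp add: nth_append)
    also have "(\<forall>k. Suc k < length t \<longrightarrow> ?P (t @ [c]) (b @ [j]) k) \<longleftrightarrow>
        (\<forall>k. Suc k < length t \<longrightarrow> ?P t b k)"
      using assms by (simp add: nth_append)
    finally show ?thesis using b by (simp add: imp_conjL)
  qed
  show ?thesis unfolding bottom_row_def using assms 1 2 3 by auto
qed

lemma compatible_pairs_step:
  assumes w: "w \<in> S_Z" and "j \<le> c"
  shows "card (compatible_pairs j c w m) = card (compatible_pairs j (c + 1) w m) +
    (if j \<in># m \<and> w (c + 1) < w c
     then card (compatible_pairs j (c + 1) (w \<circ> simple_refl c) (m - {#j#})) else 0)"
proof -
  define E where "E = {(t, b) \<in> compatible_pairs j c w m. b \<noteq> [] \<and> last b = j \<and> last t = c}"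
  let ?R = "compatible_pairs j (c + 1) (w \<circ> simple_refl c) (m - {#j#})"
  have split: "compatible_pairs j c w m = compatible_pairs j (c + 1) w m \<union> E"
    by (auto simp: compatible_pairs_def E_def)
  have disj: "compatible_pairs j (c + 1) w m \<inter> E = {}"
    by (auto simp: compatible_pairs_def E_def)
  have E_D: "\<exists>s a. t = s @ [c] \<and> b = a @ [j] \<and> (s, a) \<in> ?R \<and> j \<in># m \<and> w (c + 1) < w c"
    if "(t, b) \<in> E" for t b
  proof -
    have tb: "t \<in> RW w" "bottom_row t b" "mset b = m" "\<forall>x\<in>#m. x \<le> j" "b \<noteq> []" "last b = j"
      "last t = c"
      using that by (auto simp: E_def compatible_pairs_def)
    have len: "length b = length t" using tb by (simp add: bottom_row_def)
    define s a where "s = butlast t" and "a = butlast b"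
    have "t \<noteq> []" using tb(5) len by auto
    then have t: "t = s @ [c]" using tb(7) by (metis append_butlast_last_id s_def)
    have b: "b = a @ [j]" using tb(5,6) by (metis append_butlast_last_id a_def)
    have len': "length a = length s" using len t b by simp
    have bot: "bottom_row s a" "a \<noteq> [] \<Longrightarrow> last a = j \<Longrightarrow> \<not> last s < c"
      using tb(2) bottom_row_snoc [OF len', of c j] unfolding t b by auto
    have s: "s \<in> RW (w \<circ> simple_refl c)" "w (c + 1) < w c"
      using tb(1) RW_snoc [OF w] unfolding t by auto
    \<comment> \<open>The repeated entry \<open>j\<close> forces \<open>c \<le> last s\<close>, and
      equality would repeat the letter \<open>c\<close> in a reduced word.\<close>
    have "c + 1 \<le> last s" if "a \<noteq> []" "last a = j"
    proof -
      have "s \<noteq> []" using that len' by auto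
      then obtain r d where r: "s = r @ [d]" by (metis rev_exhaust)
      have "d \<noteq> c" using s RW_snoc [of "w \<circ> simple_refl c" r d] w unfolding r by auto
      then show ?thesis using bot(2) [OF that] by (simp add: r)
    qed
    then have "(s, a) \<in> ?R"
      using s bot tb(3,4) b by (auto simp: compatible_pairs_def dest: in_diffD)
    then show ?thesis using t b s tb(3) by auto
  qed
  have R_D: "(s @ [c], a @ [j]) \<in> E" if "(s, a) \<in> ?R" "j \<in># m" "w (c + 1) < w c" for s a
  proof -
    have sa: "s \<in> RW (w \<circ> simple_refl c)" "bottom_row s a" "mset a = m - {#j#}"
      "\<forall>x\<in>#m - {#j#}. x \<le> j" "a \<noteq> [] \<Longrightarrow> last a = j \<Longrightarrow> c + 1 \<le> last s"
      using that by (auto simp: compatible_pairs_def)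
    have len: "length a = length s" using sa by (simp add: bottom_row_def)
    have "last a \<le> j" if "a \<noteq> []" using sa(3,4) that by (metis last_in_set set_mset_mset)
    then have "bottom_row (s @ [c]) (a @ [j])"
      using bottom_row_snoc [OF len, of c j] sa(2,5) assms(2) by force
    moreover have "mset (a @ [j]) = m" using sa(3) that(2) by simp
    moreover have "\<forall>x\<in>#m. x \<le> j"
      using sa(4) that(2) by (metis insert_DiffM insert_iff order_refl set_mset_add_mset_insert)
    ultimately show ?thesis
      using sa(1) that RW_snoc [OF w, of s c] by (auto simp: E_def compatible_pairs_def)
  qed
  have "card E = (if j \<in># m \<and> w (c + 1) < w c then card ?R else 0)"
  proof (cases "j \<in># m \<and> w (c + 1) < w c")
    case True
    have "E = (\<lambda>(s, a). (s @ [c], a @ [j])) ` ?R"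
      using E_D R_D True by (fastforce simp: image_iff)
    then show ?thesis using True by (simp add: card_image inj_on_def case_prod_unfold prod_eq_iff)
  next
    case False
    then have "E = {}" using E_D by auto
    then show ?thesis using False by auto
  qed
  moreover have "finite E" "finite (compatible_pairs j (c + 1) w m)"
    using finite_compatible_pairs [OF w] split by (metis finite_Un)+
  ultimately show ?thesis unfolding split using card_Un_disjoint [OF _ _ disj] by simp
qed

definition trunc :: "int \<Rightarrow> (int \<Rightarrow> int) \<Rightarrow> ser" where
  "trunc j w = proj (\<lambda>m. \<forall>x\<in>#m. x \<le> j) (Sch w)"

text \<open>Interpolates between two truncations: as \<open>c\<close> decreases from the bound
  \<open>N\<close> of \<open>fixes_above\<close> to \<open>j\<close>, it passes from
  \<open>trunc (j - 1) w\<close> to \<open>trunc j w\<close>, gaining one factor per step.\<close>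

definition pair_series :: "int \<Rightarrow> int \<Rightarrow> (int \<Rightarrow> int) \<Rightarrow> ser" where
  "pair_series j c w = Ser (\<lambda>m. int (card (compatible_pairs j c w m)))"

lemma coef_pair_series: "coef (pair_series j c w) m = int (card (compatible_pairs j c w m))"
  by (simp add: pair_series_def Ser_inverse)

lemma pair_series_step:
  assumes "w \<in> S_Z" "j \<le> c"
  shows "pair_series j c w = hop (X j) c (pair_series j (c + 1)) w"
  by (rule ser_eqI)
     (simp add: coef_pair_series hop_def uop_def coef_X_mult compatible_pairs_step [OF assms])

lemma pair_series_top:
  assumes "w \<in> fixes_above N"
  shows "pair_series j N w = trunc (j - 1) w"
proof (rule ser_eqI)
  fix m
  have w: "w \<in> S_Z" using assms by (simp add: fixes_above_def)
  have "compatible_pairs j N w m = (if \<forall>x\<in>#m. x \<le> j - 1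
      then {(t, b). t \<in> RW w \<and> bottom_row t b \<and> mset b = m} else {})"
  proof -
    have le: "x \<le> j - 1" if "(t, b) \<in> compatible_pairs j N w m" "x \<in># m" for t b x
    proof -
      have tb: "t \<in> RW w" "bottom_row t b" "mset b = m" "\<forall>x\<in>#m. x \<le> j"
        "b \<noteq> [] \<and> last b = j \<longrightarrow> N \<le> last t"
        using that by (auto simp: compatible_pairs_def)
      have "b \<noteq> []" "length b = length t" using tb that by (auto simp: bottom_row_def)
      then have "t \<noteq> []" by auto
      then have "last t < N" using RW_letters_less [OF assms tb(1), of "last t"] by simp
      then have "last b \<noteq> j" using tb(5) \<open>b \<noteq> []\<close> by auto
      moreover have "last b \<le> j" using tb(3,4) \<open>b \<noteq> []\<close> by auto
      moreover have "x \<le> last b"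
        using tb(2,3) that(2) \<open>b \<noteq> []\<close>
        by (cases b rule: rev_cases) (auto simp: bottom_row_def sorted_append)
      ultimately show ?thesis by simp
    qed
    show ?thesis
    proof (cases "\<forall>x\<in>#m. x \<le> j - 1")
      case True
      have "(t, b) \<in> compatible_pairs j N w m"
        if "t \<in> RW w" "bottom_row t b" "mset b = m" for t b
      proof -
        have "last b \<le> j - 1" if "b \<noteq> []"
          using True that \<open>mset b = m\<close> last_in_set by fastforce
        then show ?thesis using that True by (auto simp: compatible_pairs_def)
      qed
      then show ?thesis using True by (auto simp: compatible_pairs_def)
    next
      case False
      then show ?thesis using le by auto
    qed
  qed
  then show "coef (pair_series j N w) m = coef (trunc (j - 1) w) m"
    by (simp add: coef_pair_series trunc_def proj.rep_eq coef_Sch [OF w])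
qed

lemma pair_series_bottom:
  assumes "w \<in> S_Z"
  shows "pair_series j j w = trunc j w"
proof (rule ser_eqI)
  fix m
  have "j \<le> last t" if "bottom_row t b" "b \<noteq> []" "last b = j" for t b
  proof -
    have "length b = length t" using that(1) by (simp add: bottom_row_def)
    then show ?thesis using that
      by (cases b rule: rev_cases; cases t rule: rev_cases) (auto simp: bottom_row_snoc)
  qed
  then have "compatible_pairs j j w m = (if \<forall>x\<in>#m. x \<le> j
      then {(t, b). t \<in> RW w \<and> bottom_row t b \<and> mset b = m} else {})"
    by (auto simp: compatible_pairs_def)
  then show "coef (pair_series j j w) m = coef (trunc j w) m"
    by (simp add: coef_pair_series trunc_def proj.rep_eq coef_Sch [OF assms])
qed

lemma trunc_step:
  assumes "w \<in> fixes_above N" "j \<le> N"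
  shows "trunc j w = Aop N (nat (N - j)) (X j) (trunc (j - 1)) w"
proof -
  have "pair_series j (N - int k) w = Aop N k (X j) (trunc (j - 1)) w"
    if "j \<le> N - int k" "w \<in> fixes_above N" for k w
    using that
  proof (induction k arbitrary: w)
    case 0
    then show ?case by (simp add: pair_series_top)
  next
    case (Suc k)
    have w: "w \<in> S_Z" using Suc.prems by (simp add: fixes_above_def)
    have "pair_series j (N - int (Suc k)) w =
        hop (X j) (N - int (Suc k)) (pair_series j (N - int k)) w"
      using pair_series_step [OF w, of j "N - int (Suc k)"] Suc.prems by (simp add: algebra_simps)
    also have "\<dots> = hop (X j) (N - int (Suc k)) (Aop N k (X j) (trunc (j - 1))) w"
      by (rule hop_cong [OF Suc.prems(2)]) (use Suc in simp)
    finally show ?case by (simp only: Aop.simps)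
  qed
  from this [of "nat (N - j)" w] show ?thesis
    using assms pair_series_bottom [of w j] by (simp add: fixes_above_def)
qed

section \<open>Exchange of two neighbouring variables\<close>

lemma sw_Aop: "sw a (Aop N k x F w) = Aop N k (sw a x) (\<lambda>w. sw a (F w)) w"
  by (induction k arbitrary: w) (simp_all add: hop_def uop_def sw_mult)

lemma sw_trunc:
  assumes "j < a"
  shows "sw a (trunc j w) = trunc j w"
proof (rule ser_eqI)
  fix m
  have iff: "(\<forall>x\<in>#image_mset (simple_refl a) m. x \<le> j) \<longleftrightarrow> (\<forall>x\<in>#m. x \<le> j)"
  proof
    assume *: "\<forall>x\<in>#image_mset (simple_refl a) m. x \<le> j"
    show "\<forall>x\<in>#m. x \<le> j"
    proof
      fix x assume "x \<in># m"
      then have "simple_refl a x \<le> j" using * by auto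
      then show "x \<le> j"
        using assms by (auto simp: simple_refl_def transpose_def split: if_splits)
    qed
  qed (use assms in \<open>auto simp: simple_refl_def transpose_def\<close>)
  show "coef (sw a (trunc j w)) m = coef (trunc j w) m"
  proof (cases "\<forall>x\<in>#m. x \<le> j")
    case True
    then have "image_mset (simple_refl a) m = image_mset (\<lambda>x. x) m"
      by (intro image_mset_cong) (use assms in \<open>auto simp: simple_refl_other\<close>)
    then show ?thesis by (simp add: sw.rep_eq)
  next
    case False
    with iff show ?thesis by (simp only: sw.rep_eq trunc_def proj.rep_eq if_False)
  qed
qed

text \<open>For \<open>j = a + 1\<close> the last two products carry \<open>X a\<close> and
  \<open>X (a + 1)\<close>, while \<open>trunc (a - 1)\<close> is fixed by \<open>sw a\<close>; so
  \<open>sw a\<close> only exchanges the parameters, which \<open>Aop_swap\<close> expresses by one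
  further factor. The product for a larger \<open>j\<close> has only letters above
  \<open>a + 1\<close> and commutes with that factor.\<close>

lemma trunc_exchange:
  assumes "w \<in> fixes_above N" "a + 1 \<le> j" "j \<le> N"
  shows "sw a (trunc j w) = hop (X (a + 1) - X a) a (trunc j) w"
  using assms(2,1,3)
proof (induction j arbitrary: w rule: int_ge_induct)
  case base
  define k where "k = nat (N - (a + 1))"
  have a: "N - int (Suc k) = a" using base by (simp add: k_def)
  have ka: "nat (N - a) = Suc k" using base by (simp add: k_def nat_diff_distrib')
  let ?x = "X a" and ?y = "X (a + 1)" and ?F = "trunc (a - 1)"
  have T: "trunc (a + 1) w = Aop N k ?y (Aop N (Suc k) ?x ?F) w" if "w \<in> fixes_above N" for w
  proof -
    have "trunc (a + 1) w = Aop N k ?y (trunc a) w"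
      using trunc_step [OF that, of "a + 1"] base by (simp add: k_def)
    also have "\<dots> = Aop N k ?y (Aop N (Suc k) ?x ?F) w"
      by (rule Aop_cong [OF that]) (use trunc_step [of _ N a] base ka in simp)
    finally show ?thesis .
  qed
  have "sw a (trunc (a + 1) w) = Aop N k ?x (Aop N (Suc k) ?y ?F) w"
    unfolding T [OF base(1)] sw_Aop sw_X simple_refl_simps by (simp only: sw_trunc)
  also have "\<dots> = hop (?y - ?x) a (Aop N k ?y (Aop N (Suc k) ?x ?F)) w"
    using fun_cong [OF Aop_swap [of ?y ?x N k ?F], of w] by (simp only: a)
  also have "\<dots> = hop (?y - ?x) a (trunc (a + 1)) w"
    by (rule hop_cong [OF base(1)]) (simp only: T)
  finally show ?case .
next
  case (step j)
  define k where "k = nat (N - (j + 1))"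
  let ?z = "X (a + 1) - X a"
  have T: "trunc (j + 1) w = Aop N k (X (j + 1)) (trunc j) w" if "w \<in> fixes_above N" for w
    using trunc_step [OF that, of "j + 1"] step.prems by (simp add: k_def)
  have "sw a (trunc (j + 1) w) = Aop N k (X (j + 1)) (\<lambda>w. sw a (trunc j w)) w"
    unfolding T [OF step.prems(1)] sw_Aop sw_X using step.hyps by (simp add: simple_refl_other)
  also have "\<dots> = Aop N k (X (j + 1)) (hop ?z a (trunc j)) w"
    by (rule Aop_cong [OF step.prems(1)]) (use step in simp)
  also have "\<dots> = hop ?z a (Aop N k (X (j + 1)) (trunc j)) w"
    by (subst hop_Aop_commute) (use step in \<open>simp_all add: k_def\<close>)
  also have "\<dots> = hop ?z a (trunc (j + 1)) w"
    by (rule hop_cong [OF step.prems(1)]) (simp only: T)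
  finally show ?case .
qed

lemma Sch_support:
  assumes "w \<in> fixes_above N" "coef (Sch w) m \<noteq> 0"
  shows "size m = card (inversions w)" "\<forall>x\<in>#m. x \<le> N"
proof -
  have w: "w \<in> S_Z" using assms by (simp add: fixes_above_def)
  have "{(t, b). t \<in> RW w \<and> bottom_row t b \<and> mset b = m} \<noteq> {}"
    using assms(2) coef_Sch [OF w, of m] by (metis card.empty int_ops(1))
  then obtain t b where tb: "t \<in> RW w" "bottom_row t b" "mset b = m" by auto
  then show "size m = card (inversions w)" using w by (auto simp: bottom_row_def RW_iff)
  show "\<forall>x\<in>#m. x \<le> N"
  proof
    fix x assume "x \<in># m"
    then obtain k where "k < length b" "b ! k = x" using tb(3) by (metis in_set_conv_nth set_mset_mset)
    then have "x \<le> t ! k" "t ! k \<in> set t" using tb(2) by (auto simp: bottom_row_def)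
    then show "x \<le> N" using RW_letters_less [OF assms(1) tb(1)] by fastforce
  qed
qed

text \<open>Truncating at a bound \<open>N\<close> for all variables changes nothing, so
  \<open>trunc_exchange\<close> becomes the equation defining the divided difference.\<close>

lemma dd_Sch:
  assumes "w \<in> S_Z"
  shows "dd a (Sch w) = (if w (a + 1) < w a then Sch (w \<circ> simple_refl a) else 0)"
proof (rule dd_eqI)
  obtain N where N: "w \<in> fixes_above N" "N \<ge> a + 1" using S_Z_fixes_above [OF assms] .
  have T: "trunc N w = Sch w" if "w \<in> fixes_above N" for w
    by (rule ser_eqI) (use Sch_support(2) [OF that] in \<open>auto simp: trunc_def proj.rep_eq\<close>)
  have "sw a (Sch w) = hop (X (a + 1) - X a) a (trunc N) w"
    using trunc_exchange [OF N(1) N(2)] T [OF N(1)] by simp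
  also have "\<dots> = hop (X (a + 1) - X a) a Sch w"
    by (rule hop_cong [OF N(1)]) (rule T)
  finally show "(X a - X (a + 1)) * (if w (a + 1) < w a then Sch (w \<circ> simple_refl a) else 0) =
      Sch w - sw a (Sch w)"
    by (simp add: hop_def uop_def algebra_simps)
qed

subsection \<open>Expansion in back-stable Schubert series\<close>

lemma Sch_id [simp]: "Sch id = 1"
proof (rule ser_eqI)
  fix m
  have "{(t, b). t \<in> RW id \<and> bottom_row t b \<and> mset b = m} = (if m = {#} then {([], [])} else {})"
    by (auto simp: RW_iff word_perm_Nil bottom_row_def)
  then show "coef (Sch id) m = coef 1 m" by (simp add: coef_Sch)
qed

lemma Sch_nonneg: "w \<in> S_Z \<Longrightarrow> coef (Sch w) m \<ge> 0"
  by (simp add: coef_Sch)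

lemma Sch_nonzero: "w \<in> S_Z \<Longrightarrow> Sch w \<noteq> 0"
proof (induction w rule: S_Z_induct)
  case (descent w a)
  then show ?case by (metis dd_Sch dd_zero)
next
  case id
  show ?case unfolding Sch_id by (rule one_neq_zero)
qed

text \<open>The condition describing \<open>back_stable_coeff\<close>, for an arbitrary series; see
  \<open>back_stable_coeff_expands\<close>.\<close>

definition expands :: "ser \<Rightarrow> ((int \<Rightarrow> int) \<Rightarrow> int) \<Rightarrow> bool" where
  "expands f c \<longleftrightarrow> finite {w. c w \<noteq> 0} \<and> {w. c w \<noteq> 0} \<subseteq> S_Z \<and>
     f = (\<Sum>w | c w \<noteq> 0. of_int (c w) * Sch w)"

lemma expandsI:
  assumes "finite A" "A \<subseteq> S_Z" "\<And>w. c w \<noteq> 0 \<Longrightarrow> w \<in> A" "f = (\<Sum>w\<in>A. of_int (c w) * Sch w)"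
  shows "expands f c"
proof -
  have "{w. c w \<noteq> 0} \<subseteq> A" using assms(3) by auto
  moreover have "(\<Sum>w\<in>A. of_int (c w) * Sch w) = (\<Sum>w | c w \<noteq> 0. of_int (c w) * Sch w)"
    by (rule sum.mono_neutral_right) (use assms in auto)
  ultimately show ?thesis using assms unfolding expands_def by (metis finite_subset subset_trans)
qed

lemma expands_sum:
  assumes "expands f c" "finite A" "{w. c w \<noteq> 0} \<subseteq> A"
  shows "f = (\<Sum>w\<in>A. of_int (c w) * Sch w)"
proof -
  have "(\<Sum>w | c w \<noteq> 0. of_int (c w) * Sch w) = (\<Sum>w\<in>A. of_int (c w) * Sch w)"
    by (rule sum.mono_neutral_left) (use assms in auto)
  then show ?thesis using assms(1) by (simp add: expands_def)
qed

lemma expands_diff: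
  assumes "expands f c" "expands g d"
  shows "expands (f - g) (\<lambda>w. c w - d w)"
proof (rule expandsI)
  let ?A = "{w. c w \<noteq> 0} \<union> {w. d w \<noteq> 0}"
  show A: "finite ?A" and "?A \<subseteq> S_Z" using assms by (auto simp: expands_def)
  show "f - g = (\<Sum>w\<in>?A. of_int (c w - d w) * Sch w)"
    using expands_sum [OF assms(1) A] expands_sum [OF assms(2) A]
    by (simp add: left_diff_distrib sum_subtractf)
qed auto

text \<open>Only terms at descents survive \<open>dd a\<close>, and right multiplication by the
  reflection carries them injectively to ascents, so no two terms merge.\<close>

lemma expands_dd:
  assumes "expands f c"
  shows "expands (dd a f) (\<lambda>w. if w a < w (a + 1) then c (w \<circ> simple_refl a) else 0)"
proof (rule expandsI)
  let ?A = "{w. c w \<noteq> 0}" and ?D = "{w. c w \<noteq> 0 \<and> w (a + 1) < w a}"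
  let ?s = "\<lambda>w. w \<circ> simple_refl a"
  have fin: "finite ?A" and sub: "?A \<subseteq> S_Z" and f: "f = (\<Sum>w\<in>?A. of_int (c w) * Sch w)"
    using assms by (auto simp: expands_def)
  have finD: "finite ?D" by (rule finite_subset [OF _ fin]) auto
  then show "finite (?s ` ?D)" by simp
  show "?s ` ?D \<subseteq> S_Z" using sub by auto
  show "w \<in> ?s ` ?D" if "(if w a < w (a + 1) then c (w \<circ> simple_refl a) else 0) \<noteq> 0" for w
    using that by (intro image_eqI [of _ _ "w \<circ> simple_refl a"]) (auto split: if_splits)
  have "dd a f = (\<Sum>w\<in>?A. of_int (c w) * (if w (a + 1) < w a then Sch (?s w) else 0))"
    unfolding f dd_sum dd_of_int_mult by (rule sum.cong) (use sub dd_Sch in auto)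
  also have "\<dots> = (\<Sum>w\<in>?D. of_int (c w) * Sch (?s w))"
    by (rule sum.mono_neutral_cong_right) (use fin in auto)
  also have "\<dots> = (\<Sum>w\<in>?s ` ?D. of_int (if w a < w (a + 1) then c (?s w) else 0) * Sch w)"
  proof (rule sum.reindex_cong [of ?s ?D, symmetric])
    show "inj_on ?s ?D" by (metis (no_types, lifting) comp_refl_refl inj_onI)
  qed auto
  finally show "dd a f = (\<Sum>w\<in>?s ` ?D. of_int (if w a < w (a + 1) then c (?s w) else 0) * Sch w)" .
qed

lemma expands_zero_id:
  assumes "expands 0 c" and id: "\<And>w. c w \<noteq> 0 \<Longrightarrow> w = id"
  shows "c w = 0"
proof -
  have "(0 :: ser) = (\<Sum>w\<in>{id}. of_int (c w) * Sch w)"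
    by (rule expands_sum [OF assms(1)]) (use id in blast)+
  also have "\<dots> = of_int (c id) * Sch id"
    by (simp only: sum.insert [OF finite.emptyI] sum.empty add_0_right empty_iff not_False_eq_True)
  finally have "coef 0 {#} = coef (of_int (c id) * Sch id) {#}" by (rule arg_cong)
  then have "c id = 0" by (simp only: coef_of_int_mult Sch_id) simp
  then show ?thesis using id by metis
qed

text \<open>Linear independence, by induction on a bound for the inversions in the support: if a
  permutation in the support has a descent \<open>a\<close>, then \<open>dd a\<close> yields a
  relation with a smaller bound that is still nontrivial. Hence only \<open>id\<close> can
  occur.\<close>

lemma expands_zeroD:
  assumes "expands 0 c"
  shows "c w = 0"
proof -
  have *: "\<And>c w. expands 0 c \<Longrightarrow> (\<And>w. c w \<noteq> 0 \<Longrightarrow> card (inversions w) \<le> n) \<Longrightarrow> c w = 0" for n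
  proof (induction n)
    case (0 c w)
    show "c w = 0"
    proof (rule expands_zero_id [OF 0(1)])
      fix w assume w: "c w \<noteq> 0"
      have "w \<in> S_Z" "card (inversions w) = 0" using 0 w by (auto simp: expands_def)
      then show "w = id" using S_Z_no_descent card_inversions_descent by fastforce
    qed
  next
    case (Suc n c w)
    have desc: "\<not> v (a + 1) < v a" if v: "c v \<noteq> 0" for a v
    proof
      assume a: "v (a + 1) < v a"
      let ?d = "\<lambda>w. if w a < w (a + 1) then c (w \<circ> simple_refl a) else 0"
      have "expands 0 ?d" using expands_dd [OF Suc.prems(1), of a] by simp
      moreover have "card (inversions w) \<le> n" if "?d w \<noteq> 0" for w
      proof -
        have asc: "w a < w (a + 1)" and "c (w \<circ> simple_refl a) \<noteq> 0"
          using that by (auto split: if_splits)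
        then have "w \<in> S_Z" "card (inversions (w \<circ> simple_refl a)) \<le> Suc n"
          using Suc.prems S_Z_comp_refl unfolding expands_def by blast+
        then show ?thesis using card_inversions_ascent [OF _ asc] by simp
      qed
      ultimately have "?d (v \<circ> simple_refl a) = 0" by (rule Suc.IH)
      then show False using a v by simp
    qed
    show "c w = 0"
    proof (rule expands_zero_id [OF Suc.prems(1)])
      fix v assume v: "c v \<noteq> 0"
      then have "v \<in> S_Z" using Suc.prems(1) by (auto simp: expands_def)
      then show "v = id" using S_Z_no_descent desc [OF v] by blast
    qed
  qed
  have "card (inversions v) \<le> Max ((\<lambda>w. card (inversions w)) ` {w. c w \<noteq> 0})"
    if "c v \<noteq> 0" for v
    using that assms by (intro Max_ge) (auto simp: expands_def)
  then show ?thesis by (rule * [OF assms])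
qed

lemma expands_unique:
  assumes "expands f c" "expands f d"
  shows "c = d"
proof
  fix w
  show "c w = d w" using expands_zeroD [of "\<lambda>w. c w - d w" w] expands_diff [OF assms] by simp
qed

section \<open>Homogeneity, variables bounded above, symmetry in the variables far below\<close>

definition homogeneous :: "nat \<Rightarrow> ser \<Rightarrow> bool" where
  "homogeneous n f \<longleftrightarrow> (\<forall>m. coef f m \<noteq> 0 \<longrightarrow> size m = n)"

definition bounded_vars :: "ser \<Rightarrow> bool" where
  "bounded_vars f \<longleftrightarrow> (\<exists>N. \<forall>m. coef f m \<noteq> 0 \<longrightarrow> (\<forall>x\<in>#m. x \<le> N))"

definition back_symmetric :: "ser \<Rightarrow> bool" where
  "back_symmetric f \<longleftrightarrow> (\<exists>M. \<forall>a<M. sw a f = f)"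

lemma coef_mult_nonzero:
  assumes "coef (f * g) m \<noteq> 0"
  obtains p q where "m = p + q" "coef f p \<noteq> 0" "coef g q \<noteq> 0"
proof -
  have "(\<Sum>(p, q)\<in>{(p, q). p + q = m}. coef f p * coef g q) \<noteq> 0"
    using assms by (simp add: times_ser.rep_eq series_mult_def)
  then obtain x where "x \<in> {(p, q). p + q = m}" "(case x of (p, q) \<Rightarrow> coef f p * coef g q) \<noteq> 0"
    by (rule sum.not_neutral_contains_not_neutral)
  then show ?thesis using that by auto
qed

lemma homogeneous_mult:
  "homogeneous k f \<Longrightarrow> homogeneous n g \<Longrightarrow> homogeneous (k + n) (f * g)"
  unfolding homogeneous_def by (metis coef_mult_nonzero size_union)

lemma bounded_vars_mult:
  assumes "bounded_vars f" "bounded_vars g"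
  shows "bounded_vars (f * g)"
proof -
  obtain M N where *: "\<And>m x. coef f m \<noteq> 0 \<Longrightarrow> x \<in># m \<Longrightarrow> x \<le> M"
    "\<And>m x. coef g m \<noteq> 0 \<Longrightarrow> x \<in># m \<Longrightarrow> x \<le> N"
    using assms unfolding bounded_vars_def by metis
  have "x \<le> max M N" if "coef (f * g) m \<noteq> 0" "x \<in># m" for m x
    using that(1)
  proof (rule coef_mult_nonzero)
    fix p q assume "m = p + q" "coef f p \<noteq> 0" "coef g q \<noteq> 0"
    then show ?thesis using * [of p x] *(2) [of q x] that(2) by auto
  qed
  then show ?thesis unfolding bounded_vars_def by blast
qed

lemma back_symmetric_mult:
  assumes "back_symmetric f" "back_symmetric g"
  shows "back_symmetric (f * g)"
proof -
  obtain M N where "\<And>a. a < M \<Longrightarrow> sw a f = f" "\<And>a. a < N \<Longrightarrow> sw a g = g"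
    using assms unfolding back_symmetric_def by metis
  then show ?thesis unfolding back_symmetric_def
    by (intro exI [of _ "min M N"]) (simp add: sw_mult)
qed

lemma homogeneous_dd:
  assumes "homogeneous (Suc n) f"
  shows "homogeneous n (dd a f)"
  unfolding homogeneous_def
  using dd_support [of f "\<lambda>m. size m = Suc n" a "\<lambda>m. size m = n"] assms
  by (simp add: homogeneous_def)

lemma image_refl_all_le:
  assumes "a + 1 \<le> N"
  shows "(\<forall>x\<in>#image_mset (simple_refl a) m. x \<le> N) \<longleftrightarrow> (\<forall>x\<in>#m. x \<le> N)"
proof -
  have "simple_refl a x \<le> N \<longleftrightarrow> x \<le> N" for x
    using assms by (simp add: simple_refl_def transpose_def)
  then show ?thesis by simp
qed

lemma bounded_vars_dd:
  assumes "bounded_vars f"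
  shows "bounded_vars (dd a f)"
proof -
  obtain M where M: "\<And>m x. coef f m \<noteq> 0 \<Longrightarrow> x \<in># m \<Longrightarrow> x \<le> M"
    using assms unfolding bounded_vars_def by metis
  define N where "N = max M (a + 1)"
  let ?Q = "\<lambda>m :: int multiset. \<forall>x\<in>#m. x \<le> N"
  have "?Q m" if "coef (dd a f) m \<noteq> 0" for m
  proof (rule dd_support [of f ?Q a])
    show "?Q m" if "coef f m \<noteq> 0" for m using M [OF that] by (force simp: N_def)
    show "?Q (image_mset (simple_refl a) m) = ?Q m" for m
      by (rule image_refl_all_le) (simp add: N_def)
  qed (use that in \<open>auto simp: N_def\<close>)
  then show ?thesis unfolding bounded_vars_def by blast
qed

lemma back_symmetric_dd:
  assumes "back_symmetric f"
  shows "back_symmetric (dd a f)"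
proof -
  obtain M where "\<And>a. a < M \<Longrightarrow> sw a f = f" using assms unfolding back_symmetric_def by metis
  then have "sw b (dd a f) = dd a f" if "b < min M (a - 1)" for b
    using that sw_dd_commute [of a b f] by simp
  then show ?thesis unfolding back_symmetric_def by blast
qed

lemma homogeneous_Sch: "w \<in> S_Z \<Longrightarrow> homogeneous (card (inversions w)) (Sch w)"
  unfolding homogeneous_def by (metis S_Z_fixes_above Sch_support(1))

lemma bounded_vars_Sch: "w \<in> S_Z \<Longrightarrow> bounded_vars (Sch w)"
  unfolding bounded_vars_def by (metis S_Z_fixes_above Sch_support(2))

lemma back_symmetric_Sch:
  assumes "w \<in> S_Z"
  shows "back_symmetric (Sch w)"
proof -
  obtain l h where "\<And>i. i < l \<Longrightarrow> w i = i" "\<And>i. h < i \<Longrightarrow> w i = i"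
    using S_Z_bounds [OF assms] by metis
  then have "sw a (Sch w) = Sch w" if "a < l - 1" for a
    using that dd_Sch [OF assms, of a] by (simp add: dd_eq_0_iff)
  then show ?thesis unfolding back_symmetric_def by blast
qed

lemma bounded_vars_sw:
  assumes "bounded_vars f"
  obtains N where "\<And>a. N < a \<Longrightarrow> sw a f = f"
proof -
  obtain N where N: "\<And>m x. coef f m \<noteq> 0 \<Longrightarrow> x \<in># m \<Longrightarrow> x \<le> N"
    using assms unfolding bounded_vars_def by metis
  have *: "coef f (image_mset (simple_refl a) m) = coef f m" if "N < a" "coef f m \<noteq> 0" for a m
  proof -
    have "image_mset (simple_refl a) m = image_mset (\<lambda>x. x) m"
      by (intro image_mset_cong) (use N [OF that(2)] that(1) in \<open>force simp: simple_refl_other\<close>)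
    then show ?thesis by simp
  qed
  have "sw a f = f" if "N < a" for a
  proof (rule ser_eqI)
    fix m
    show "coef (sw a f) m = coef f m"
      using * [OF that, of m] * [OF that, of "image_mset (simple_refl a) m"]
      unfolding sw.rep_eq image_refl_invol by metis
  qed
  then show ?thesis using that by blast
qed

text \<open>Such a series is invariant under all reflections, so an index occurring in a monomial of
  its support can be raised step by step beyond the bound. Positive degree supplies an index to
  start with.\<close>

lemma dd_all_zero:
  assumes dd: "\<And>a. dd a f = 0" and "bounded_vars f" "homogeneous (Suc n) f"
  shows "f = 0"
proof (rule ser_eqI, rule ccontr)
  fix m assume "coef f m \<noteq> coef 0 m"
  then have m: "coef f m \<noteq> 0" by simp
  then have "size m = Suc n" using assms(3) by (simp add: homogeneous_def)
  then obtain x where x: "x \<in># m" by (metis multiset_nonemptyE size_empty nat.distinct(1))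
  obtain N where N: "\<And>m x. coef f m \<noteq> 0 \<Longrightarrow> x \<in># m \<Longrightarrow> x \<le> N"
    using assms(2) unfolding bounded_vars_def by metis
  have sym: "coef f (image_mset (simple_refl a) m) = coef f m" for a m
    using dd [of a] by (metis dd_eq_0_iff sw.rep_eq)
  have "\<exists>m. coef f m \<noteq> 0 \<and> x + int k \<in># m" for k
  proof (induction k)
    case 0
    then show ?case using m x by auto
  next
    case (Suc k)
    then obtain m where m: "coef f m \<noteq> 0" "x + int k \<in># m" by blast
    have "simple_refl (x + int k) (x + int k) \<in># image_mset (simple_refl (x + int k)) m"
      using m(2) by (simp del: simple_refl_simps)
    then show ?case using m(1) sym [of "x + int k" m]
      by (intro exI [of _ "image_mset (simple_refl (x + int k)) m"]) (auto simp: algebra_simps)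
  qed
  from this [of "nat (N + 1 - x)"] obtain m where "coef f m \<noteq> 0" "x + int (nat (N + 1 - x)) \<in># m"
    by blast
  then have "x + int (nat (N + 1 - x)) \<le> N" by (rule N)
  then show False by (simp split: if_splits)
qed

text \<open>Induction on the degree: the expansions of all \<open>dd a f\<close> are glued into a
  candidate \<open>F\<close> with the same divided differences, and \<open>dd_all_zero\<close> gives
  \<open>f = F\<close>.\<close>

lemma Schubert_expansion:
  assumes "homogeneous n f" "bounded_vars f" "back_symmetric f"
  shows "\<exists>c. expands f c \<and> (\<forall>w. c w \<noteq> 0 \<longrightarrow> card (inversions w) = n)"
  using assms
proof (induction n arbitrary: f)
  case 0
  have "f = of_int (coef f {#}) * Sch id"
    by (rule ser_eqI) (use 0(1) in \<open>auto simp: homogeneous_def coef_of_int\<close>)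
  then have "expands f (\<lambda>w. if w = id then coef f {#} else 0)"
    by (intro expandsI [of "{id}"]) (auto split: if_splits)
  moreover have "card (inversions w) = 0" if "(if w = id then coef f {#} else 0) \<noteq> 0" for w
    using that by (metis card_inversions_id)
  ultimately show ?case by blast
next
  case (Suc n f)
  let ?s = "\<lambda>w a. w \<circ> simple_refl a"
  have "\<exists>c. expands (dd a f) c \<and> (\<forall>w. c w \<noteq> 0 \<longrightarrow> card (inversions w) = n)" for a
    by (rule Suc.IH) (use Suc.prems homogeneous_dd bounded_vars_dd back_symmetric_dd in auto)
  then obtain C where C: "\<And>a. expands (dd a f) (C a)"
    "\<And>a w. C a w \<noteq> 0 \<Longrightarrow> card (inversions w) = n"
    by metis
  have C_S_Z: "w \<in> S_Z" if "C a w \<noteq> 0" for a w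
    using C(1) [of a] that by (auto simp: expands_def)
  \<comment> \<open>Comes from \<open>dd a (dd a f) = 0\<close>: a coefficient at a descent would
    survive in its expansion.\<close>
  have asc: "w a < w (a + 1)" if "C a w \<noteq> 0" for a w
  proof (rule ccontr)
    assume "\<not> w a < w (a + 1)"
    then have "w (a + 1) < w a" using C_S_Z [OF that] S_Z_not_descent by blast
    moreover have "expands 0 (\<lambda>w. if w a < w (a + 1) then C a (?s w a) else 0)"
      using expands_dd [OF C(1) [of a], of a] by simp
    ultimately show False using expands_zeroD [of _ "?s w a"] that by fastforce
  qed
  text \<open>The candidate coefficient at \<open>w\<close> does not depend on the descent used to compute it, since
    the divided differences satisfy the braid relations and expansions are unique.\<close>
  have consistent: "C a (?s w a) = C b (?s w b)"
    if a: "w (a + 1) < w a" and b: "w (b + 1) < w b" and "a < b" for w a b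
  proof (cases "b = a + 1")
    case False
    then have far: "a + 1 < b" using \<open>a < b\<close> by simp
    have refl: "simple_refl a b = b" "simple_refl a (b + 1) = b + 1"
      "simple_refl b a = a" "simple_refl b (a + 1) = a + 1"
      using far by (auto simp: simple_refl_other)
    have comm: "dd a (dd b f) = dd b (dd a f)" using far by (intro dd_commute) simp
    \<comment> \<open>Both functions expand the same series; evaluated at
      \<open>?s (?s w a) b\<close> they give the two candidates.\<close>
    have "(\<lambda>w. if w b < w (b + 1) then C a (?s w b) else 0) =
        (\<lambda>w. if w a < w (a + 1) then C b (?s w a) else 0)"
      using expands_dd [OF C(1) [of a], of b] expands_dd [OF C(1) [of b], of a]
      unfolding comm by (rule expands_unique)
    from fun_cong [OF this, of "?s (?s w a) b"] refl a b
    have "C a (?s (?s (?s w a) b) b) = C b (?s (?s (?s w a) b) a)" by simp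
    moreover have "?s (?s (?s w a) b) b = ?s w a" by simp
    moreover have "?s (?s w a) b = ?s (?s w b) a"
      using refl_commute [of a b] far by (simp add: comp_assoc)
    then have "?s (?s (?s w a) b) a = ?s w b" by simp
    ultimately show ?thesis by simp
  next
    case True
    let ?D = "\<lambda>a b c w. if w a < w (a + 1) then if (?s w a) b < (?s w a) (b + 1)
      then C c (?s (?s w a) b) else 0 else 0"
    have braid: "dd a (dd b (dd a f)) = dd b (dd a (dd b f))" unfolding True by (rule dd_braid)
    have "?D a b a = ?D b a b"
      using expands_dd [OF expands_dd [OF C(1) [of a], of b], of a]
        expands_dd [OF expands_dd [OF C(1) [of b], of a], of b]
      unfolding braid by (rule expands_unique)
    then have D: "?D a b a v = ?D b a b v" for v by (rule fun_cong)
    \<comment> \<open>\<open>w\<close> decreases along \<open>a\<close>, \<open>a + 1\<close>,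
      \<open>a + 2\<close>. These values are reversed in \<open>v\<close>, so all conditions in
      \<open>?D\<close> hold at \<open>v\<close>.\<close>
    define v where "v = ?s (?s (?s w a) b) a"
    have v': "v = ?s (?s (?s w b) a) b"
      unfolding v_def True using refl_braid [of a] by (simp add: comp_assoc)
    have asc_v: "v a < v (a + 1)" "v b < v (b + 1)" "(?s v a) b < (?s v a) (b + 1)"
      "(?s v b) a < (?s v b) (a + 1)"
      using a b by (auto simp: v_def True simple_refl_def transpose_def)
    have "C a (?s (?s v a) b) = C b (?s (?s v b) a)" using D [of v] asc_v by simp
    moreover have "?s (?s v a) b = ?s w a" by (simp add: v_def)
    moreover have "?s (?s v b) a = ?s w b" by (simp add: v')
    ultimately show ?thesis by simp
  qed
  \<comment> \<open>By \<open>consistent\<close> any descent may be chosen. The identity gets 0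
    because \<open>f\<close> has positive degree.\<close>
  define c where "c w = (if w \<in> S_Z \<and> (\<exists>a. w (a + 1) < w a)
    then let a = SOME a. w (a + 1) < w a in C a (?s w a) else 0)" for w
  have c: "c w = C a (?s w a)" if "w \<in> S_Z" "w (a + 1) < w a" for w a
  proof -
    define b where "b = (SOME a. w (a + 1) < w a)"
    have b: "w (b + 1) < w b" unfolding b_def using that(2) by (rule someI)
    have "c w = C b (?s w b)" using that by (auto simp: c_def Let_def b_def)
    moreover have "C b (?s w b) = C a (?s w a)"
    proof (cases a b rule: linorder_cases)
      case less
      then show ?thesis using consistent [OF that(2) b] by simp
    next
      case greater
      then show ?thesis using consistent [OF b that(2)] by simp
    qed simp
    ultimately show ?thesis by (rule trans)
  qed
  have c_supp: "\<exists>a. C a (?s w a) \<noteq> 0" if "c w \<noteq> 0" for w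
    using that unfolding c_def Let_def by (auto split: if_splits)
  \<comment> \<open>Only letters in \<open>{M..N}\<close> can have \<open>dd a f \<noteq> 0\<close>,
    which makes the support of \<open>c\<close> finite.\<close>
  obtain M where M: "\<And>a. a < M \<Longrightarrow> sw a f = f" using Suc.prems(3) unfolding back_symmetric_def by metis
  obtain N where N: "\<And>a. N < a \<Longrightarrow> sw a f = f" using bounded_vars_sw [OF Suc.prems(2)] by metis
  have C_range: "a \<in> {M..N}" if "C a w \<noteq> 0" for a w
  proof (rule ccontr)
    assume "a \<notin> {M..N}"
    then have "a < M \<or> N < a" by auto
    then have "dd a f = 0" using M N by (auto simp: dd_eq_0_iff)
    then show False using C(1) [of a] expands_zeroD that by metis
  qed
  have "{w. c w \<noteq> 0} \<subseteq> (\<Union>a\<in>{M..N}. (\<lambda>w. ?s w a) ` {w. C a w \<noteq> 0})"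
  proof
    fix w assume "w \<in> {w. c w \<noteq> 0}"
    then obtain a where "C a (?s w a) \<noteq> 0" using c_supp by auto
    moreover have "w = ?s (?s w a) a" by simp
    ultimately show "w \<in> (\<Union>a\<in>{M..N}. (\<lambda>w. ?s w a) ` {w. C a w \<noteq> 0})" using C_range by blast
  qed
  moreover have "finite {w. C a w \<noteq> 0}" for a using C(1) [of a] by (simp add: expands_def)
  ultimately have fin: "finite {w. c w \<noteq> 0}" by (auto intro: finite_subset)
  define F where "F = (\<Sum>w | c w \<noteq> 0. of_int (c w) * Sch w)"
  have c_S_Z: "w \<in> S_Z" if "c w \<noteq> 0" for w
    using that unfolding c_def by (auto split: if_splits)
  have F: "expands F c" using fin c_S_Z by (auto simp: expands_def F_def)
  have dd_F: "dd a (f - F) = 0" for a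
  proof -
    have "(if w a < w (a + 1) then c (?s w a) else 0) = C a w" for w
    proof (cases "w a < w (a + 1) \<and> w \<in> S_Z")
      case True
      then show ?thesis using c [of "?s w a" a] by simp
    next
      case False
      then have "C a w = 0" using asc C_S_Z by blast
      moreover have "c (?s w a) = 0" if "w \<notin> S_Z" using c_S_Z that S_Z_comp_refl by blast
      ultimately show ?thesis using False by auto
    qed
    then have "expands (dd a F) (C a)" using expands_dd [OF F, of a] by simp
    then have "dd a F = dd a f" using C(1) [of a] unfolding expands_def by metis
    then show ?thesis by (simp add: dd_diff)
  qed
  have c_deg: "card (inversions w) = Suc n" if "c w \<noteq> 0" for w
  proof -
    obtain a where a: "C a (?s w a) \<noteq> 0" using c_supp [OF \<open>c w \<noteq> 0\<close>] by blast
    then show ?thesis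
      using card_inversions_ascent [OF C_S_Z [OF a] asc [OF a]] C(2) [OF a]
      by (simp only: comp_refl_refl)
  qed
  have coef_F: "\<exists>w. c w \<noteq> 0 \<and> coef (Sch w) m \<noteq> 0" if "coef F m \<noteq> 0" for m
  proof -
    have "(\<Sum>w | c w \<noteq> 0. c w * coef (Sch w) m) \<noteq> 0"
      using that by (simp add: F_def coef_sum coef_of_int_mult)
    then show ?thesis by (rule sum.not_neutral_contains_not_neutral) auto
  qed
  have "homogeneous (Suc n) F"
    unfolding homogeneous_def
  proof (intro allI impI)
    fix m assume "coef F m \<noteq> 0"
    then obtain w where "c w \<noteq> 0" "coef (Sch w) m \<noteq> 0" using coef_F by blast
    then show "size m = Suc n" using homogeneous_Sch [OF c_S_Z] c_deg by (metis homogeneous_def)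
  qed
  then have "homogeneous (Suc n) (f - F)"
    using Suc.prems(1) unfolding homogeneous_def minus_ser.rep_eq by (metis diff_self)
  moreover have "bounded_vars (f - F)"
  proof -
    obtain K where K: "\<And>m x. coef f m \<noteq> 0 \<Longrightarrow> x \<in># m \<Longrightarrow> x \<le> K"
      using Suc.prems(2) unfolding bounded_vars_def by metis
    obtain L where L: "\<And>w m x. c w \<noteq> 0 \<Longrightarrow> coef (Sch w) m \<noteq> 0 \<Longrightarrow> x \<in># m \<Longrightarrow> x \<le> L w"
      using bounded_vars_Sch [OF c_S_Z] unfolding bounded_vars_def by metis
    define B where "B = Max (insert K (L ` {w. c w \<noteq> 0}))"
    have B: "K \<le> B" "c w \<noteq> 0 \<Longrightarrow> L w \<le> B" for w
      using fin by (auto simp: B_def)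
    have "x \<le> B" if "coef (f - F) m \<noteq> 0" "x \<in># m" for m x
    proof (cases "coef f m \<noteq> 0")
      case True
      then show ?thesis using K [OF True that(2)] B by simp
    next
      case False
      then have "coef F m \<noteq> 0" using that by simp
      then obtain w where "c w \<noteq> 0" "coef (Sch w) m \<noteq> 0" using coef_F by blast
      then show ?thesis using L [of w m x] B(2) [of w] that(2) by simp
    qed
    then show ?thesis unfolding bounded_vars_def by blast
  qed
  ultimately have "f - F = 0" using dd_all_zero dd_F by blast
  then show ?case using F c_deg by auto
qed

subsection \<open>The iterated Leibniz rule\<close>

text \<open>\<open>foldr\<close> applies the largest letter first, so the sorted letters act like an
  increasing suffix of a reduced word.\<close>

definition dds :: "int set \<Rightarrow> ser \<Rightarrow> ser" where
  "dds J f = foldr dd (sorted_list_of_set J) f"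

lemma dds_empty [simp]: "dds {} f = f"
  by (simp add: dds_def)

lemma dds_insert:
  assumes "finite J" "\<And>x. x \<in> J \<Longrightarrow> a < x"
  shows "dds (insert a J) f = dd a (dds J f)"
proof -
  have "a \<notin> J" using assms(2) by blast
  then have "sorted_list_of_set (insert a J) = a # sorted_list_of_set J"
    using assms by (subst sorted_list_of_set_unique [symmetric]) auto
  then show ?thesis by (simp add: dds_def)
qed

text \<open>The coefficients of the iterated Leibniz rule: applying the divided differences with letters
  in \<open>A\<close> (largest letter first) to \<open>f * g\<close> gives the sum of
  \<open>leibniz_coeff A i n J K * dds J f * dds K g\<close>, once every
  \<open>sw a f\<close> has been rewritten as \<open>f - (X a - X (a + 1)) * dd a f\<close>.\<close>

primrec leibniz_coeff :: "int set \<Rightarrow> int \<Rightarrow> nat \<Rightarrow> int set \<Rightarrow> int set \<Rightarrow> ser" where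
  "leibniz_coeff A i 0 J K = 1"
| "leibniz_coeff A i (Suc n) J K =
    (let a = i - int n; P = leibniz_coeff A i n (J - {a}) (K - {a}) in
     if a \<notin> A then (if a \<in> J \<or> a \<in> K then 0 else P)
     else if a \<in> J \<and> a \<in> K then (X (a + 1) - X a) * sw a P
     else if a \<in> J \<or> a \<in> K then sw a P
     else dd a P)"

abbreviation letters :: "int \<Rightarrow> nat \<Rightarrow> int set" where
  "letters i n \<equiv> {i - int n<..i}"

lemma letters_Suc: "letters i (Suc n) = insert (i - int n) (letters i n)"
  by auto

lemma sum_Pow_insert:
  assumes "finite I" "a \<notin> I"
  shows "(\<Sum>J\<in>Pow (insert a I). h J) = (\<Sum>J\<in>Pow I. h J + h (insert a J))"
proof -
  have "inj_on (insert a) (Pow I)"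
    using assms(2) unfolding inj_on_def by (metis Diff_insert_absorb Pow_iff subsetD)
  moreover have "Pow I \<inter> insert a ` Pow I = {}" using assms(2) by auto
  ultimately show ?thesis
    using assms(1) by (simp add: Pow_insert sum.union_disjoint sum.reindex sum.distrib)
qed

text \<open>Each pair of subsets of the old letters has four extensions with or without the new
  letter \<open>a\<close>. Their terms add up to \<open>dd a\<close> of the old term if
  \<open>a \<in> A\<close>, and to the old term otherwise.\<close>

lemma leibniz_dds:
  "dds (A \<inter> letters i n) (f * g) =
    (\<Sum>J\<in>Pow (letters i n). \<Sum>K\<in>Pow (letters i n). leibniz_coeff A i n J K * dds J f * dds K g)"
proof (induction n)
  case 0
  show ?case by simp
next
  case (Suc n)
  define a I where "a = i - int n" and "I = letters i n"
  have fin: "finite I" and aI: "a \<notin> I" and less: "\<And>x. x \<in> I \<Longrightarrow> a < x"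
    by (auto simp: a_def I_def)
  have I': "letters i (Suc n) = insert a I" unfolding letters_Suc a_def I_def ..
  let ?P = "leibniz_coeff A i n" and ?P' = "leibniz_coeff A i (Suc n)"
  let ?F = "\<lambda>J. dds J f" and ?G = "\<lambda>K. dds K g"
  have diff: "J - {a} = J" "insert a J - {a} = J" if "J \<subseteq> I" for J using that aI by auto
  have ins: "dds (insert a J) h = dd a (dds J h)" if "J \<subseteq> I" for J h
    using that fin less by (intro dds_insert) (auto intro: finite_subset)
  have IH: "dds (A \<inter> I) (f * g) = (\<Sum>J\<in>Pow I. \<Sum>K\<in>Pow I. ?P J K * ?F J * ?G K)"
    using Suc.IH by (simp add: I_def)
  have "(\<Sum>J\<in>Pow (insert a I). \<Sum>K\<in>Pow (insert a I). ?P' J K * ?F J * ?G K) =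
    (\<Sum>J\<in>Pow I. \<Sum>K\<in>Pow I. ?P' J K * ?F J * ?G K + ?P' J (insert a K) * ?F J * ?G (insert a K) +
      (?P' (insert a J) K * ?F (insert a J) * ?G K +
       ?P' (insert a J) (insert a K) * ?F (insert a J) * ?G (insert a K)))"
    by (simp add: sum_Pow_insert [OF fin aI] sum.distrib add_ac del: leibniz_coeff.simps)
  also have "\<dots> = (if a \<in> A then dd a (dds (A \<inter> I) (f * g)) else dds (A \<inter> I) (f * g))"
  proof (cases "a \<in> A")
    case False
    have eq: "?P' J K * ?F J * ?G K + ?P' J (insert a K) * ?F J * ?G (insert a K) +
      (?P' (insert a J) K * ?F (insert a J) * ?G K +
       ?P' (insert a J) (insert a K) * ?F (insert a J) * ?G (insert a K)) = ?P J K * ?F J * ?G K"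
      if "J \<in> Pow I" "K \<in> Pow I" for J K
    proof -
      have "a \<notin> J" "a \<notin> K" using that aI by auto
      then show ?thesis using that False by (simp add: Let_def diff flip: a_def)
    qed
    show ?thesis unfolding IH if_not_P [OF False] by (intro sum.cong refl eq)
  next
    case True
    have eq: "?P' J K * ?F J * ?G K + ?P' J (insert a K) * ?F J * ?G (insert a K) +
      (?P' (insert a J) K * ?F (insert a J) * ?G K +
       ?P' (insert a J) (insert a K) * ?F (insert a J) * ?G (insert a K)) =
      dd a (?P J K * ?F J * ?G K)"
      if JK: "J \<in> Pow I" "K \<in> Pow I" for J K
    proof -
      have mem: "a \<notin> J" "a \<notin> K" "J \<subseteq> I" "K \<subseteq> I" using JK aI by auto
      define P F G where "P = ?P J K" and "F = ?F J" and "G = ?G K"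
      have sw_F: "sw a F = F - (X a - X (a + 1)) * dd a F" by (simp add: dd_mult_diff)
      have "dd a (P * F * G) = dd a P * F * G + sw a P * dd a F * G + sw a P * sw a F * dd a G"
        by (simp only: dd_mult sw_mult distrib_right)
      also have "\<dots> = dd a P * F * G + sw a P * F * dd a G +
          (sw a P * dd a F * G + (X (a + 1) - X a) * sw a P * dd a F * dd a G)"
        unfolding sw_F by (simp add: algebra_simps)
      finally show ?thesis
        using mem True by (simp add: Let_def diff ins P_def F_def G_def flip: a_def)
    qed
    show ?thesis unfolding IH if_P [OF True] dd_sum by (intro sum.cong refl eq)
  qed
  also have "\<dots> = dds (A \<inter> insert a I) (f * g)"
    using ins [of "A \<inter> I"] by (simp add: Int_insert_right)
  finally show ?case unfolding I' ..
qed

text \<open>A letter of \<open>A\<close> changes the degree by the number of the sets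
  \<open>J\<close>, \<open>K\<close> containing it, minus one. The earlier coefficient has only
  variables above \<open>a\<close>, so a step brings in no variable below
  \<open>X a\<close>.\<close>

lemma leibniz_coeff_support:
  assumes "J \<subseteq> letters i n" "K \<subseteq> letters i n" "coef (leibniz_coeff A i n J K) m \<noteq> 0"
  shows "size m + card (A \<inter> letters i n) = card J + card K" "\<forall>x\<in>#m. i - int n < x"
proof -
  have "size m + card (A \<inter> letters i n) = card J + card K \<and> (\<forall>x\<in>#m. i - int n < x)"
    using assms
  proof (induction n arbitrary: J K m)
    case 0
    then show ?case by (auto split: if_splits)
  next
    case (Suc n)
    define a I where "a = i - int n" and "I = letters i n"
    define P where "P = leibniz_coeff A i n (J - {a}) (K - {a})"
    have I': "letters i (Suc n) = insert a I" unfolding letters_Suc a_def I_def ..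
    have aI: "a \<notin> I" "finite I" by (auto simp: a_def I_def)
    have finJK: "finite J" "finite K" using Suc.prems finite_subset by blast+
    define j0 k0 where "j0 = card (J - {a})" and "k0 = card (K - {a})"
    have P: "size m + card (A \<inter> I) = j0 + k0 \<and> (\<forall>x\<in>#m. a < x)"
      if "coef P m \<noteq> 0" for m
      unfolding j0_def k0_def a_def I_def
    proof (rule Suc.IH)
      show "J - {i - int n} \<subseteq> letters i n" "K - {i - int n} \<subseteq> letters i n"
        using Suc.prems by auto
      show "coef (leibniz_coeff A i n (J - {i - int n}) (K - {i - int n})) m \<noteq> 0"
        using that by (simp add: P_def a_def)
    qed
    have le: "i - int (Suc n) < x \<longleftrightarrow> a \<le> x" for x by (auto simp: a_def)
    have cA: "card (A \<inter> insert a I) = card (A \<inter> I) + (if a \<in> A then 1 else 0)"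
      using aI by simp
    have "card S = card (S - {a}) + (if a \<in> S then 1 else 0)" if "finite S" for S
      using card_Suc_Diff1 [OF that, of a] by (cases "a \<in> S") auto
    then have cJ: "card J = j0 + (if a \<in> J then 1 else 0)" "card K = k0 + (if a \<in> K then 1 else 0)"
      using finJK by (simp_all only: j0_def k0_def)
    have sw_P: "size m + card (A \<inter> I) = j0 + k0 \<and> (\<forall>x\<in>#m. a \<le> x)"
      if "coef (sw a P) m \<noteq> 0" for m
    proof -
      have *: "size m + card (A \<inter> I) = j0 + k0"
        "\<And>x. x \<in># m \<Longrightarrow> a < simple_refl a x"
        using P [OF that [unfolded sw.rep_eq]] by simp_all
      have "a \<le> x" if "x \<in># m" for x
        using *(2) [OF that] by (auto simp: simple_refl_def transpose_def split: if_splits)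
      with * show ?thesis by auto
    qed
    have step: "coef (if a \<notin> A then (if a \<in> J \<or> a \<in> K then 0 else P)
       else if a \<in> J \<and> a \<in> K then (X (a + 1) - X a) * sw a P
       else if a \<in> J \<or> a \<in> K then sw a P else dd a P) m \<noteq> 0"
      using Suc.prems(3) unfolding leibniz_coeff.simps Let_def a_def [symmetric] P_def [symmetric] .
    show ?case
    proof (cases "a \<in> A")
      case False
      then show ?thesis unfolding I' le using step P [of m] cA cJ
        by (auto split: if_splits intro: less_imp_le)
    next
      case True
      consider "a \<in> J" "a \<in> K" | "a \<in> J \<longleftrightarrow> a \<notin> K" | "a \<notin> J" "a \<notin> K" by blast
      then show ?thesis
      proof cases
        case 1
        then have "coef (X (a + 1) * sw a P) m - coef (X a * sw a P) m \<noteq> 0"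
          using step True by (simp add: left_diff_distrib)
        then have "coef (X (a + 1) * sw a P) m \<noteq> 0 \<or> coef (X a * sw a P) m \<noteq> 0" by linarith
        then obtain b where b: "b = a \<or> b = a + 1" "b \<in># m" "coef (sw a P) (m - {#b#}) \<noteq> 0"
          by (auto simp: coef_X_mult split: if_splits)
        obtain m' where m': "m = add_mset b m'" using b(2) by (metis multi_member_split)
        show ?thesis unfolding I' le using sw_P [OF b(3)] b(1) 1 True cA cJ
          by (auto simp: m')
      next
        case 2
        then show ?thesis unfolding I' le using step True sw_P [of m] cA cJ
          by (auto split: if_splits)
      next
        case 3
        then have dd: "coef (dd a P) m \<noteq> 0" using step True by simp
        have "Suc (size m) + card (A \<inter> I) = j0 + k0"
          by (rule dd_support
              [where Q = "\<lambda>m. size m + card (A \<inter> I) = j0 + k0"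
                and Q' = "\<lambda>m. Suc (size m) + card (A \<inter> I) = j0 + k0",
                OF _ _ _ _ dd])
             (use P in auto)
        moreover have "\<forall>x\<in>#m. a \<le> x"
        proof (rule dd_support [where Q = "\<lambda>m. \<forall>x\<in>#m. a \<le> x", OF _ _ _ _ dd])
          show "\<forall>x\<in>#m. a \<le> x" if "coef P m \<noteq> 0" for m
            using P [OF that] by (auto intro: less_imp_le)
          have "a \<le> simple_refl a x \<longleftrightarrow> a \<le> x" for x
            by (simp add: simple_refl_def transpose_def)
          then show "(\<forall>x\<in>#image_mset (simple_refl a) m. a \<le> x) = (\<forall>x\<in>#m. a \<le> x)" for m
            by simp
        qed auto
        ultimately show ?thesis unfolding I' le using 3 True cA cJ by simp
      qed
    qed
  qed
  then show "size m + card (A \<inter> letters i n) = card J + card K" "\<forall>x\<in>#m. i - int n < x"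
    by blast+
qed

text \<open>Only the monomials in the last active variable can still contribute to the constant term
  later on; their signed coefficients obey a recursion without signs and cancellations.\<close>

definition lead :: "int set \<Rightarrow> int \<Rightarrow> nat \<Rightarrow> int set \<Rightarrow> int set \<Rightarrow> nat \<Rightarrow> int" where
  "lead A i n J K d =
    (- 1) ^ d * coef (leibniz_coeff A i n J K) (replicate_mset d (i - int n + 1))"

lemma lead_0: "lead A i 0 J K d = (if d = 0 then 1 else 0)"
  by (simp add: lead_def)

text \<open>The earlier coefficient \<open>P\<close> is free of \<open>X a\<close>. Hence
  \<open>sw a\<close> turns powers of \<open>X (a + 1)\<close> into powers of \<open>X a\<close>,
  \<open>dd a\<close> lowers such a power with a minus sign, and \<open>X (a + 1) - X a\<close>
  contributes only \<open>- X a\<close>; the sign in \<open>lead\<close> absorbs both minus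
  signs.\<close>

lemma lead_Suc:
  fixes i n
  defines "a \<equiv> i - int n"
  assumes "J \<subseteq> letters i (Suc n)" "K \<subseteq> letters i (Suc n)"
  shows "lead A i (Suc n) J K d =
    (if a \<notin> A then if a \<in> J \<or> a \<in> K \<or> d > 0 then 0 else lead A i n J K 0
     else if a \<in> J \<and> a \<in> K then if d = 0 then 0 else lead A i n (J - {a}) (K - {a}) (d - 1)
     else if a \<in> J \<or> a \<in> K then lead A i n (J - {a}) (K - {a}) d
     else lead A i n J K (Suc d))"
proof -
  define P where "P = leibniz_coeff A i n (J - {a}) (K - {a})"
  have sub: "J - {a} \<subseteq> letters i n" "K - {a} \<subseteq> letters i n"
    using assms(2,3) unfolding letters_Suc a_def by auto
  have var: "i - int (Suc n) + 1 = a" "i - int n + 1 = a + 1" by (simp_all add: a_def)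
  have P_lead: "lead A i n (J - {a}) (K - {a}) k = (- 1) ^ k * coef P (replicate_mset k (a + 1))"
    for k by (simp only: lead_def P_def var)
  have P_a: "coef P m = 0" if "a \<in># m" for m
  proof (rule ccontr)
    assume "coef P m \<noteq> 0"
    from leibniz_coeff_support(2) [OF sub this [unfolded P_def]] that
    show False by (auto simp: a_def)
  qed
  have sw_P: "coef (sw a P) (replicate_mset k a) = coef P (replicate_mset k (a + 1))" for k
    by (simp add: sw.rep_eq)
  have step: "lead A i (Suc n) J K d = (- 1) ^ d *
    coef (if a \<notin> A then (if a \<in> J \<or> a \<in> K then 0 else P)
       else if a \<in> J \<and> a \<in> K then (X (a + 1) - X a) * sw a P
       else if a \<in> J \<or> a \<in> K then sw a P else dd a P) (replicate_mset d a)"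
    unfolding lead_def var leibniz_coeff.simps Let_def a_def [symmetric] P_def [symmetric] ..
  show ?thesis
  proof (cases "a \<in> A")
    case False
    show ?thesis
    proof (cases "d = 0")
      case True
      then show ?thesis unfolding step using False P_lead [of 0]
        by (cases "a \<in> J"; cases "a \<in> K") simp_all
    next
      case d: False
      then have "coef P (replicate_mset d a) = 0" by (intro P_a) simp
      then show ?thesis unfolding step using False d by simp
    qed
  next
    case True
    consider "a \<in> J" "a \<in> K" | "a \<in> J \<longleftrightarrow> a \<notin> K" | "a \<notin> J" "a \<notin> K" by blast
    then show ?thesis
    proof cases
      case 1
      have "coef ((X (a + 1) - X a) * sw a P) (replicate_mset d a) =
          (if d = 0 then 0 else - coef P (replicate_mset (d - 1) (a + 1)))"
      proof (cases d)
        case (Suc e)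
        have "a + 1 \<notin># replicate_mset d a" by (auto split: if_splits)
        then show ?thesis using Suc sw_P [of e] by (simp add: left_diff_distrib coef_X_mult)
      qed (simp add: left_diff_distrib coef_X_mult)
      then show ?thesis unfolding step using 1 True P_lead [of "d - 1"] by (cases d) simp_all
    next
      case 2
      then show ?thesis unfolding step using True P_lead [of d] sw_P [of d] by auto
    next
      case 3
      have "coef P (replicate_mset (Suc d) a) = 0" by (rule P_a) simp
      then show ?thesis unfolding step
        using 3 True P_lead [of "Suc d"] coef_dd_power [of a P d] by simp
    qed
  qed
qed

lemma lead_nonneg:
  assumes "J \<subseteq> letters i n" "K \<subseteq> letters i n"
  shows "lead A i n J K d \<ge> 0"
  using assms
proof (induction n arbitrary: J K d)
  case 0
  then show ?case by (simp add: lead_0)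
next
  case (Suc n)
  have "lead A i n (J - {i - int n}) (K - {i - int n}) e \<ge> 0" for e
    by (rule Suc.IH) (use Suc.prems in auto)
  moreover have "J - {i - int n} = J" if "i - int n \<notin> J" using that by simp
  moreover have "K - {i - int n} = K" if "i - int n \<notin> K" using that by simp
  ultimately show ?case unfolding lead_Suc [OF Suc.prems] by (auto split: if_splits; metis)
qed

lemma leibniz_coeff_cong:
  assumes "\<And>k. k < n \<Longrightarrow> i - int k \<in> A \<longleftrightarrow> i - int k \<in> B"
  shows "leibniz_coeff A i n J K = leibniz_coeff B i n J K"
  using assms by (induction n arbitrary: J K) (simp_all add: Let_def)

lemma lead_insert:
  assumes "a \<le> i - int n"
  shows "lead (insert a A) i n J K d = lead A i n J K d"
proof -
  have "leibniz_coeff (insert a A) i n J K = leibniz_coeff A i n J K"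
    by (rule leibniz_coeff_cong) (use assms in auto)
  then show ?thesis by (simp add: lead_def)
qed

text \<open>Go down through the letters and put each letter of \<open>J\<close> or \<open>K\<close>
  into \<open>A\<close>. A letter in both raises the exponent \<open>d\<close> by one; a letter in
  neither goes into \<open>A\<close> if \<open>d > 0\<close>, and then lowers it by one.\<close>

lemma lead_one_exists:
  assumes "finite J" "finite K" "J \<subseteq> {..i}" "K \<subseteq> {..i}"
  shows "\<exists>A n. A \<subseteq> letters i n \<and> J \<subseteq> letters i n \<and> K \<subseteq> letters i n \<and> lead A i n J K 0 = 1"
proof -
  have partial: "\<exists>A d. A \<subseteq> letters i n \<and> lead A i n (J \<inter> letters i n) (K \<inter> letters i n) d = 1" for n
  proof (induction n)
    case 0
    show ?case by (intro exI [of _ "{}"] exI [of _ 0]) (simp add: lead_0)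
  next
    case (Suc n)
    then obtain A d where A: "A \<subseteq> letters i n"
      and lead: "lead A i n (J \<inter> letters i n) (K \<inter> letters i n) d = 1" by blast
    define a where "a = i - int n"
    define J' K' where "J' = J \<inter> letters i (Suc n)" and "K' = K \<inter> letters i (Suc n)"
    define J0 K0 where "J0 = J \<inter> letters i n" and "K0 = K \<inter> letters i n"
    have lead0: "lead A i n J0 K0 d = 1" using lead by (simp add: J0_def K0_def)
    have aA: "a \<notin> A" using A by (auto simp: a_def)
    have diff: "J' - {a} = J0" "K' - {a} = K0"
      by (auto simp: a_def J'_def K'_def J0_def K0_def)
    have mem: "a \<in> J' \<longleftrightarrow> a \<in> J" "a \<in> K' \<longleftrightarrow> a \<in> K" by (auto simp: a_def J'_def K'_def)
    have mem0: "a \<notin> J0" "a \<notin> K0" by (auto simp: a_def J0_def K0_def)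
    have diff': "a \<notin> J \<Longrightarrow> J' = J0" "a \<notin> K \<Longrightarrow> K' = K0"
      using diff mem by blast+
    have ins: "lead (insert a A) i n J1 K1 e = lead A i n J1 K1 e" for J1 K1 e
      by (rule lead_insert) (simp add: a_def)
    have ex: "\<exists>A d. A \<subseteq> letters i (Suc n) \<and>
        lead A i (Suc n) (J \<inter> letters i (Suc n)) (K \<inter> letters i (Suc n)) d = 1"
      if "B = A \<or> B = insert a A" "lead B i (Suc n) J' K' e = 1" for B e
    proof -
      have "B \<subseteq> letters i (Suc n)" using that(1) A by (auto simp: a_def)
      then show ?thesis using that(2) unfolding J'_def K'_def by blast
    qed
    have sub: "J' \<subseteq> letters i (Suc n)" "K' \<subseteq> letters i (Suc n)" by (auto simp: J'_def K'_def)
    note lead_Suc' = lead_Suc [OF sub, folded a_def]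
    consider "a \<in> J" "a \<in> K" | "a \<in> J \<or> a \<in> K" "\<not> (a \<in> J \<and> a \<in> K)" | "a \<notin> J" "a \<notin> K" by blast
    then show ?case
    proof cases
      case 1
      then show ?thesis using lead0
        by (intro ex [of "insert a A" "Suc d"]) (simp_all add: lead_Suc' mem diff ins)
    next
      case 2
      then show ?thesis using lead0
        by (intro ex [of "insert a A" d]) (auto simp: lead_Suc' mem diff ins)
    next
      case 3
      show ?thesis
      proof (cases d)
        case 0
        then have "lead A i (Suc n) J' K' 0 = 1"
          unfolding lead_Suc' using 3 lead0 aA by (simp add: mem0 diff')
        then show ?thesis by (rule ex [rotated]) simp
      next
        case (Suc e)
        then have "lead (insert a A) i (Suc n) J' K' e = 1"
          unfolding lead_Suc' using 3 lead0 by (simp add: mem0 diff' ins)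
        then show ?thesis by (rule ex [rotated]) simp
      qed
    qed
  qed
  have "bdd_below (J \<union> K)" using assms by (intro bdd_below_finite) simp
  then obtain l where l: "\<And>x. x \<in> J \<union> K \<Longrightarrow> l \<le> x" by (auto simp: bdd_below_def)
  define n where "n = nat (i - l + 1)"
  have JK: "J \<subseteq> letters i n" "K \<subseteq> letters i n"
    using l assms(3,4) by (force simp: n_def)+
  then have "J \<inter> letters i n = J" "K \<inter> letters i n = K" by blast+
  then obtain A d where A: "A \<subseteq> letters i n" "lead A i n J K d = 1" using partial [of n] by auto
  \<comment> \<open>The remaining exponent is used up by adding the next lower letters, which lie
    outside \<open>J\<close> and \<open>K\<close>.\<close>
  have "\<exists>A n. A \<subseteq> letters i n \<and> J \<subseteq> letters i n \<and> K \<subseteq> letters i n \<and> lead A i n J K 0 = 1"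
    if "A \<subseteq> letters i n" "J \<subseteq> letters i n" "K \<subseteq> letters i n" "lead A i n J K d = 1" for A n d
    using that
  proof (induction d arbitrary: A n)
    case (Suc d)
    define a where "a = i - int n"
    have "a \<notin> J" "a \<notin> K" using Suc.prems by (auto simp: a_def)
    moreover have sub: "letters i n \<subseteq> letters i (Suc n)" by auto
    ultimately have "lead (insert a A) i (Suc n) J K d = 1"
      using Suc.prems lead_insert [of a i n A] lead_Suc [of J i n K "insert a A" d]
      by (simp add: a_def del: of_nat_Suc)
    moreover have "insert a A \<subseteq> letters i (Suc n)" using Suc.prems(1) by (auto simp: a_def)
    ultimately show ?case using Suc.IH Suc.prems(2,3) sub by (meson subset_trans)
  qed blast
  then show ?thesis using A JK by blast
qed

subsection \<open>Longest increasing suffixes\<close>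

lemma finite_subset_letters:
  assumes "finite A" "A \<subseteq> {..i}"
  obtains n where "A \<subseteq> letters i n"
proof -
  obtain l where l: "\<And>x. x \<in> A \<Longrightarrow> l \<le> x"
    using bdd_below_finite [OF assms(1)] by (auto simp: bdd_below_def)
  show ?thesis
    by (rule that [of "nat (i - l + 1)"]) (use l assms(2) in force)
qed

text \<open>A term with \<open>card J > p\<close> or \<open>card K > q\<close> has a vanishing
  factor; in all others the coefficient would have negative degree.\<close>

lemma dds_mult_vanish:
  assumes f: "\<And>J. finite J \<Longrightarrow> J \<subseteq> {..i} \<Longrightarrow> p < card J \<Longrightarrow> dds J f = 0"
    and g: "\<And>K. finite K \<Longrightarrow> K \<subseteq> {..i} \<Longrightarrow> q < card K \<Longrightarrow> dds K g = 0"
    and A: "finite A" "A \<subseteq> {..i}" "p + q < card A"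
  shows "dds A (f * g) = 0"
proof -
  obtain n where n: "A \<subseteq> letters i n" using finite_subset_letters A(1,2) .
  have "leibniz_coeff A i n J K * dds J f * dds K g = 0"
    if "J \<subseteq> letters i n" "K \<subseteq> letters i n" for J K
  proof (cases "card J \<le> p \<and> card K \<le> q")
    case True
    have "coef (leibniz_coeff A i n J K) m = 0" for m
      using leibniz_coeff_support(1) [OF that, of A m] True A(3) n by (fastforce simp: Int_absorb2)
    then have "leibniz_coeff A i n J K = 0" by (intro ser_eqI) simp
    then show ?thesis by simp
  next
    case False
    have "finite J" "finite K" "J \<subseteq> {..i}" "K \<subseteq> {..i}" using that by (auto intro: finite_subset)
    then show ?thesis using False f [of J] g [of K] by (auto simp: not_le)
  qed
  then have "(\<Sum>J\<in>Pow (letters i n). \<Sum>K\<in>Pow (letters i n).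
      leibniz_coeff A i n J K * dds J f * dds K g) = 0"
    by (intro sum.neutral ballI) blast
  then show ?thesis using leibniz_dds [of A i n f g] n by (simp add: Int_absorb2)
qed

lemma coef_mult_nonneg:
  assumes "\<And>m. coef f m \<ge> 0" "\<And>m. coef g m \<ge> 0"
  shows "coef (f * g) m \<ge> 0"
  unfolding times_ser.rep_eq series_mult_def by (rule sum_nonneg) (auto simp: assms)

lemma mult_nonzero_of_nonneg:
  assumes "\<And>m. coef f m \<ge> 0" "\<And>m. coef g m \<ge> 0" "f \<noteq> 0" "g \<noteq> 0"
  obtains m where "coef (f * g) m > 0"
proof -
  obtain p q where pq: "coef f p \<noteq> 0" "coef g q \<noteq> 0"
    using assms(3,4) ser_eqI [of f 0] ser_eqI [of g 0] by auto
  have "(\<lambda>(p, q). coef f p * coef g q) (p, q) \<le> coef (f * g) (p + q)"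
    unfolding times_ser.rep_eq series_mult_def
    by (rule member_le_sum) (use assms finite_msplits in auto)
  moreover have "coef f p * coef g q > 0"
    using pq assms(1,2) by (metis mult_pos_pos order_less_le)
  ultimately show ?thesis using that [of "p + q"] by simp
qed

text \<open>With \<open>A\<close> from \<open>lead_one_exists\<close>, every surviving term has a
  constant coefficient for degree reasons, nonnegative by \<open>lead_nonneg\<close>. So nothing
  cancels the nonzero term of \<open>J\<close> and \<open>K\<close>.\<close>

lemma dds_mult_nonzero:
  assumes f: "\<And>J. finite J \<Longrightarrow> J \<subseteq> {..i} \<Longrightarrow> p < card J \<Longrightarrow> dds J f = 0"
    and g: "\<And>K. finite K \<Longrightarrow> K \<subseteq> {..i} \<Longrightarrow> q < card K \<Longrightarrow> dds K g = 0"
    and f_nonneg: "\<And>J m. coef (dds J f) m \<ge> 0" and g_nonneg: "\<And>K m. coef (dds K g) m \<ge> 0"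
    and J: "finite J" "J \<subseteq> {..i}" "card J = p" "dds J f \<noteq> 0"
    and K: "finite K" "K \<subseteq> {..i}" "card K = q" "dds K g \<noteq> 0"
  shows "\<exists>A. finite A \<and> A \<subseteq> {..i} \<and> card A = p + q \<and> dds A (f * g) \<noteq> 0"
proof -
  obtain A n where A: "A \<subseteq> letters i n" and sub: "J \<subseteq> letters i n" "K \<subseteq> letters i n"
    and lead: "lead A i n J K 0 = 1"
    using lead_one_exists [OF J(1) K(1) J(2) K(2)] by blast
  let ?P = "leibniz_coeff A i n"
  have const: "coef (?P J' K') {#} = lead A i n J' K' 0" for J' K' by (simp add: lead_def)
  have card_A: "card A = p + q"
    using leibniz_coeff_support(1) [OF sub, of A "{#}"] const [of J K] lead A J(3) K(3)
    by (simp add: Int_absorb2)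
  have P_const: "?P J' K' * dds J' f * dds K' g = of_int (lead A i n J' K' 0) * (dds J' f * dds K' g)"
    if "J' \<subseteq> letters i n" "K' \<subseteq> letters i n" for J' K'
  proof (cases "card J' \<le> p \<and> card K' \<le> q")
    case True
    have "m = {#}" if "coef (?P J' K') m \<noteq> 0" for m
    proof -
      have "size m + card A = card J' + card K'"
        using leibniz_coeff_support(1) [OF \<open>J' \<subseteq> letters i n\<close> \<open>K' \<subseteq> letters i n\<close> that] A
        by (simp add: Int_absorb2)
      then have "size m = 0" using True card_A by linarith
      then show ?thesis by simp
    qed
    then have "?P J' K' = of_int (lead A i n J' K' 0)"
      by (intro ser_eqI) (auto simp: coef_of_int const)
    then show ?thesis by (simp add: mult.assoc)
  next
    case False
    have "finite J'" "finite K'" "J' \<subseteq> {..i}" "K' \<subseteq> {..i}" using that by (auto intro: finite_subset)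
    then show ?thesis using False f [of J'] g [of K'] by (auto simp: not_le)
  qed
  obtain m where m: "coef (dds J f * dds K g) m > 0"
    using mult_nonzero_of_nonneg [OF f_nonneg g_nonneg J(4) K(4)] .
  let ?T = "\<lambda>J' K'. coef (?P J' K' * dds J' f * dds K' g) m"
  have nonneg: "?T J' K' \<ge> 0" if "J' \<subseteq> letters i n" "K' \<subseteq> letters i n" for J' K'
    using lead_nonneg [OF that] coef_mult_nonneg [OF f_nonneg g_nonneg]
    by (simp add: P_const [OF that] coef_of_int_mult)
  have "0 < ?T J K" using m lead by (simp add: P_const [OF sub] coef_of_int_mult)
  also have "\<dots> \<le> (\<Sum>K'\<in>Pow (letters i n). ?T J K')"
    by (rule member_le_sum) (use sub nonneg in auto)
  also have "\<dots> \<le> (\<Sum>J'\<in>Pow (letters i n). \<Sum>K'\<in>Pow (letters i n). ?T J' K')"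
    by (rule member_le_sum [of J]) (use sub nonneg in \<open>auto intro: sum_nonneg\<close>)
  also have "\<dots> = coef (dds A (f * g)) m"
    using leibniz_dds [of A i n f g] A by (simp add: Int_absorb2 coef_sum)
  finally have "dds A (f * g) \<noteq> 0" by auto
  moreover have "finite A" "A \<subseteq> {..i}" using A by (auto intro: finite_subset)
  ultimately show ?thesis using card_A by blast
qed

section \<open>Divided differences along suffixes of reduced words\<close>

lemma foldr_dd_Sch_reduced:
  assumes "w \<in> S_Z" "p @ s \<in> RW w"
  shows "foldr dd s (Sch w) = Sch (word_perm p)"
  using assms
proof (induction s arbitrary: w rule: rev_induct)
  case Nil
  then show ?case by (auto simp: RW_iff)
next
  case (snoc a s)
  have *: "w (a + 1) < w a" "p @ s \<in> RW (w \<circ> simple_refl a)"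
    using snoc.prems RW_snoc [of w "p @ s" a] by auto
  then have "foldr dd s (Sch (w \<circ> simple_refl a)) = Sch (word_perm p)"
    by (intro snoc.IH [OF S_Z_comp_refl [THEN iffD2, OF snoc.prems(1)]])
  then show ?case using dd_Sch [OF snoc.prems(1), of a] * by simp
qed

lemma foldr_dd_zero: "foldr dd s 0 = 0"
  by (induction s) auto

text \<open>Every divided difference must meet a descent, since otherwise it gives 0;
  \<open>RW_snoc\<close> assembles these descents into a reduced word.\<close>

lemma foldr_dd_Sch_nonzero:
  assumes "w \<in> S_Z" "foldr dd s (Sch w) \<noteq> 0"
  shows "\<exists>p. p @ s \<in> RW w"
  using assms
proof (induction s arbitrary: w rule: rev_induct)
  case Nil
  then show ?case using RW_not_empty by auto
next
  case (snoc a s)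
  have nz: "foldr dd s (dd a (Sch w)) \<noteq> 0" using snoc.prems(2) by simp
  have desc: "w (a + 1) < w a"
    by (rule ccontr) (use nz dd_Sch [OF snoc.prems(1), of a] foldr_dd_zero in simp)
  then have "dd a (Sch w) = Sch (w \<circ> simple_refl a)" using dd_Sch [OF snoc.prems(1), of a] by simp
  then have "foldr dd s (Sch (w \<circ> simple_refl a)) \<noteq> 0" using nz by (simp only:) simp
  then have "\<exists>p. p @ s \<in> RW (w \<circ> simple_refl a)"
    by (rule snoc.IH [OF S_Z_comp_refl [THEN iffD2, OF snoc.prems(1)]])
  then obtain p where "p @ s \<in> RW (w \<circ> simple_refl a)" by blast
  then show ?case using RW_snoc [OF snoc.prems(1), of "p @ s" a] desc by auto
qed

lemma dds_Sch_nonneg: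
  assumes "w \<in> S_Z"
  shows "coef (dds J (Sch w)) m \<ge> 0"
proof (cases "dds J (Sch w) = 0")
  case False
  then obtain p where "p @ sorted_list_of_set J \<in> RW w"
    using foldr_dd_Sch_nonzero [OF assms] unfolding dds_def by blast
  then show ?thesis using foldr_dd_Sch_reduced [OF assms] Sch_nonneg by (simp add: dds_def)
qed simp

text \<open>\<open>expands_dd\<close> never merges terms, so the coefficient of \<open>w\<close>
  reappears at \<open>word_perm p\<close>, and \<open>expands_zeroD\<close> excludes 0.\<close>

lemma expands_foldr_dd:
  assumes "expands f c" "c w \<noteq> 0" "p @ s \<in> RW w"
  shows "foldr dd s f \<noteq> 0"
proof -
  have "\<exists>c. expands (foldr dd s f) c \<and> c (word_perm p) \<noteq> 0"
    using assms
  proof (induction s arbitrary: f c w rule: rev_induct)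
    case (Nil f c w)
    have "w \<in> S_Z" using Nil.prems by (auto simp: expands_def)
    then have "word_perm p = w" using Nil.prems(3) by (simp add: RW_iff)
    then show ?case using Nil.prems(1,2) by auto
  next
    case (snoc a s f c w)
    have w: "w \<in> S_Z" using snoc.prems by (auto simp: expands_def)
    have *: "w (a + 1) < w a" "p @ s \<in> RW (w \<circ> simple_refl a)"
      using snoc.prems(3) RW_snoc [OF w, of "p @ s" a] by auto
    have "\<exists>c. expands (foldr dd s (dd a f)) c \<and> c (word_perm p) \<noteq> 0"
      by (rule snoc.IH [OF expands_dd [OF snoc.prems(1), of a] _ *(2)])
         (use *(1) snoc.prems(2) in simp)
    then show ?case by simp
  qed
  then show ?thesis using expands_zeroD by metis
qed

lemma foldr_dd_sum: "foldr dd s (\<Sum>x\<in>A. of_int (c x) * F x) = (\<Sum>x\<in>A. of_int (c x) * foldr dd s (F x))"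
  by (induction s) (auto simp: dd_sum dd_of_int_mult)

lemma expands_foldr_ddE:
  assumes "expands f c" "foldr dd s f \<noteq> 0"
  obtains w where "c w \<noteq> 0" "foldr dd s (Sch w) \<noteq> 0"
proof -
  have "f = (\<Sum>w | c w \<noteq> 0. of_int (c w) * Sch w)" using assms(1) by (simp add: expands_def)
  from arg_cong [OF this, of "foldr dd s"]
  have "(\<Sum>w | c w \<noteq> 0. of_int (c w) * foldr dd s (Sch w)) \<noteq> 0"
    using assms(2) by (simp only: foldr_dd_sum not_False_eq_True)
  then obtain w where "w \<in> {w. c w \<noteq> 0}" "of_int (c w) * foldr dd s (Sch w) \<noteq> 0"
    by (rule sum.not_neutral_contains_not_neutral)
  then show ?thesis using that [of w] by (metis mem_Collect_eq mult_zero_right)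
qed

section \<open>Increasing suffixes as finite sets of letters\<close>

lemma finite_inc_suffixes: "finite {length s | s. suffix s p \<and> sorted_wrt (<) s}"
  by (rule finite_subset [of _ "{..length p}"]) (auto dest: suffix_length_le)

lemma length_le_inc_suffix:
  "suffix s p \<Longrightarrow> sorted_wrt (<) s \<Longrightarrow> length s \<le> inc_suffix p"
  unfolding inc_suffix_def by (rule Max_ge [OF finite_inc_suffixes]) auto

lemma inc_suffix_witness:
  obtains s where "suffix s p" "sorted_wrt (<) s" "length s = inc_suffix p"
proof -
  have "inc_suffix p \<in> {length s | s. suffix s p \<and> sorted_wrt (<) s}"
    unfolding inc_suffix_def by (rule Max_in [OF finite_inc_suffixes]) (auto intro: exI [of _ "[]"])
  then show ?thesis using that by auto
qed

lemma card_le_max_inc_suffix: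
  assumes w: "w \<in> S_Z" and J: "finite J" "J \<subseteq> {..i}" "dds J (Sch w) \<noteq> 0"
  shows "card J \<le> max_inc_suffix_le i (RW w)"
proof (cases "J = {}")
  case False
  let ?s = "sorted_list_of_set J"
  obtain p where p: "p @ ?s \<in> RW w"
    using foldr_dd_Sch_nonzero [OF w] J(3) unfolding dds_def by blast
  have ne: "?s \<noteq> []" using False J(1) by simp
  then have "last ?s \<in> J" using J(1) by (metis last_in_set set_sorted_list_of_set)
  then have "inc_suffix_le i (p @ ?s) = inc_suffix (p @ ?s)"
    using ne J(2) by (auto simp: inc_suffix_le_def)
  moreover have "card J \<le> inc_suffix (p @ ?s)"
    using length_le_inc_suffix [OF suffixI [OF refl], of ?s p] J(1) by simp
  moreover have "inc_suffix_le i (p @ ?s) \<le> max_inc_suffix_le i (RW w)"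
    unfolding max_inc_suffix_le_def using finite_RW [OF w] p by (intro Max_ge) auto
  ultimately show ?thesis by simp
qed simp

lemma max_inc_suffix_witness:
  assumes w: "w \<in> S_Z"
  obtains J p where "finite J" "J \<subseteq> {..i}" "card J = max_inc_suffix_le i (RW w)"
    "p @ sorted_list_of_set J \<in> RW w"
proof -
  have "max_inc_suffix_le i (RW w) \<in> inc_suffix_le i ` RW w"
    unfolding max_inc_suffix_le_def using finite_RW [OF w] RW_not_empty [OF w]
    by (intro Max_in) auto
  then obtain t where t: "t \<in> RW w" "max_inc_suffix_le i (RW w) = inc_suffix_le i t" by blast
  show ?thesis
  proof (cases "t \<noteq> [] \<and> last t \<le> i")
    \<comment> \<open>\<open>inc_suffix_le\<close> takes its default value 0 here, matched by the
      empty set.\<close>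
    case False
    then have "max_inc_suffix_le i (RW w) = 0" using t(2) by (auto simp: inc_suffix_le_def)
    then show ?thesis using that [of "{}" t] t(1) by simp
  next
    case True
    obtain s where s: "suffix s t" "sorted_wrt (<) s" "length s = inc_suffix t"
      by (rule inc_suffix_witness)
    obtain p where p: "t = p @ s" using s(1) by (auto simp: suffix_def)
    have card: "card (set s) = length s"
      using s(2) by (simp add: distinct_card strict_sorted_iff)
    have list: "sorted_list_of_set (set s) = s"
      using s(2) card sorted_list_of_set_unique [of "set s" s] by simp
    \<comment> \<open>An increasing suffix is bounded by its last letter, which is the last letter
      of \<open>t\<close>.\<close>
    have "x \<le> i" if "x \<in> set s" for x
    proof -
      have "x \<le> last s" using that s(2)
        by (cases s rule: rev_cases) (auto simp: sorted_wrt_append)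
      moreover have "last s \<le> i" using True that p by (cases "s = []") auto
      ultimately show ?thesis by simp
    qed
    then show ?thesis
      using that [of "set s" p] card s(3) t True p by (auto simp: list inc_suffix_le_def)
  qed
qed

lemma back_stable_coeff_expands:
  assumes "u \<in> S_Z" "v \<in> S_Z"
  shows "expands (Sch u * Sch v) (back_stable_coeff u v)"
proof -
  obtain c where c: "expands (Sch u * Sch v) c"
    using Schubert_expansion
      [OF homogeneous_mult [OF homogeneous_Sch [OF assms(1)] homogeneous_Sch [OF assms(2)]]
        bounded_vars_mult [OF bounded_vars_Sch [OF assms(1)] bounded_vars_Sch [OF assms(2)]]
        back_symmetric_mult [OF back_symmetric_Sch [OF assms(1)] back_symmetric_Sch [OF assms(2)]]]
    by blast
  have coef_Sch: "coef (Sch w) = back_stable_schubert w" for w by (simp add: Sch_def Ser_inverse)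
  have iff: "expands (Sch u * Sch v) d \<longleftrightarrow> finite {w. d w \<noteq> 0} \<and> {w. d w \<noteq> 0} \<subseteq> S_Z \<and>
      series_mult (back_stable_schubert u) (back_stable_schubert v) =
        (\<lambda>m. \<Sum>w | d w \<noteq> 0. d w * back_stable_schubert w m)" for d
  proof -
    have "Sch u * Sch v = (\<Sum>w | d w \<noteq> 0. of_int (d w) * Sch w) \<longleftrightarrow>
        coef (Sch u * Sch v) = coef (\<Sum>w | d w \<noteq> 0. of_int (d w) * Sch w)"
      by (simp add: coef_inject)
    also have "coef (\<Sum>w | d w \<noteq> 0. of_int (d w) * Sch w) =
        (\<lambda>m. \<Sum>w | d w \<noteq> 0. d w * back_stable_schubert w m)"
      by (simp add: fun_eq_iff coef_sum coef_of_int_mult coef_Sch)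
    also have "coef (Sch u * Sch v) = series_mult (back_stable_schubert u) (back_stable_schubert v)"
      by (simp add: times_ser.rep_eq coef_Sch)
    finally show ?thesis unfolding expands_def by simp
  qed
  have "back_stable_coeff u v = c"
    unfolding back_stable_coeff_def iff [symmetric]
    by (rule the_equality) (use c expands_unique in auto)
  with c show ?thesis by simp
qed

theorem theorem5p10:
  fixes u v :: "int \<Rightarrow> int"
  assumes "u \<in> S_Z_plus" and "v \<in> S_Z_plus"
  shows "(\<forall>i::int. Max ((\<lambda>w. max_inc_suffix_le i (RW w)) ` {w \<in> S_Z. back_stable_coeff u v w \<noteq> 0})
              = max_inc_suffix_le i (RW u) + max_inc_suffix_le i (RW v)) \<and>
         (\<forall>w\<in>S_Z. (\<exists>i::int. max_inc_suffix_le i (RW w)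
                          > max_inc_suffix_le i (RW u) + max_inc_suffix_le i (RW v))
              \<longrightarrow> back_stable_coeff u v w = 0)"
proof -
  define c where "c = back_stable_coeff u v"
  have u: "u \<in> S_Z" and v: "v \<in> S_Z" using assms by (auto simp: S_Z_plus_def)
  have c: "expands (Sch u * Sch v) c" unfolding c_def by (rule back_stable_coeff_expands [OF u v])
  have c_S_Z: "w \<in> S_Z" if "c w \<noteq> 0" for w using c that by (auto simp: expands_def)
  let ?I = "\<lambda>i w. max_inc_suffix_le i (RW w)"
  have vanish: "dds J (Sch w) = 0" if "w \<in> S_Z" "finite J" "J \<subseteq> {..i}" "?I i w < card J" for i w J
    using card_le_max_inc_suffix [OF that(1-3)] that(4) by force
  \<comment> \<open>A longest increasing suffix for \<open>w\<close> gives a set \<open>J\<close>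
    with \<open>dds J\<close> nonzero on the product, and \<open>dds_mult_vanish\<close> bounds the
    size of such sets.\<close>
  have upper: "?I i w \<le> ?I i u + ?I i v" if "c w \<noteq> 0" for i w
  proof -
    obtain J p where J: "finite J" "J \<subseteq> {..i}" "card J = ?I i w" "p @ sorted_list_of_set J \<in> RW w"
      using max_inc_suffix_witness [OF c_S_Z [OF \<open>c w \<noteq> 0\<close>]] .
    then have "dds J (Sch u * Sch v) \<noteq> 0"
      unfolding dds_def using expands_foldr_dd [OF c that] by blast
    then show ?thesis
      using dds_mult_vanish [OF vanish [OF u] vanish [OF v] J(1,2)] J(3) by force
  qed
  \<comment> \<open>Sets realizing the values for \<open>u\<close> and \<open>v\<close> combine to a
    set \<open>A\<close> with \<open>dds A\<close> nonzero on the product; by linearity some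
    \<open>Sch w\<close> in the expansion survives \<open>dds A\<close>.\<close>
  have attained: "\<exists>w. c w \<noteq> 0 \<and> ?I i u + ?I i v \<le> ?I i w" for i
  proof -
    have witness: "\<exists>J. finite J \<and> J \<subseteq> {..i} \<and> card J = ?I i w \<and> dds J (Sch w) \<noteq> 0"
      if "w \<in> S_Z" for w
    proof -
      obtain J p where J: "finite J" "J \<subseteq> {..i}" "card J = ?I i w" "p @ sorted_list_of_set J \<in> RW w"
        using max_inc_suffix_witness [OF \<open>w \<in> S_Z\<close>] .
      then have "dds J (Sch w) \<noteq> 0"
        using foldr_dd_Sch_reduced [OF that J(4)] Sch_nonzero by (simp add: dds_def)
      with J show ?thesis by blast
    qed
    obtain J K where J: "finite J" "J \<subseteq> {..i}" "card J = ?I i u" "dds J (Sch u) \<noteq> 0"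
      and K: "finite K" "K \<subseteq> {..i}" "card K = ?I i v" "dds K (Sch v) \<noteq> 0"
      using witness [OF u] witness [OF v] by blast
    have "\<exists>A. finite A \<and> A \<subseteq> {..i} \<and> card A = ?I i u + ?I i v \<and> dds A (Sch u * Sch v) \<noteq> 0"
      by (rule dds_mult_nonzero [OF vanish [OF u] vanish [OF v] dds_Sch_nonneg [OF u]
          dds_Sch_nonneg [OF v] J K])
    then obtain A where A: "finite A" "A \<subseteq> {..i}" "card A = ?I i u + ?I i v"
      "dds A (Sch u * Sch v) \<noteq> 0" by blast
    obtain w where w: "c w \<noteq> 0" "dds A (Sch w) \<noteq> 0"
      using expands_foldr_ddE [OF c A(4) [unfolded dds_def]] unfolding dds_def .
    then show ?thesis using card_le_max_inc_suffix [OF c_S_Z [OF w(1)] A(1,2) w(2)] A(3) by auto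
  qed
  have support: "{w \<in> S_Z. c w \<noteq> 0} = {w. c w \<noteq> 0}" using c_S_Z by blast
  have fin: "finite {w. c w \<noteq> 0}" using c by (simp add: expands_def)
  have "Max (?I i ` {w \<in> S_Z. c w \<noteq> 0}) = ?I i u + ?I i v" for i
  proof (rule Max_eqI)
    obtain w where "c w \<noteq> 0" "?I i u + ?I i v \<le> ?I i w" using attained by blast
    then show "?I i u + ?I i v \<in> ?I i ` {w \<in> S_Z. c w \<noteq> 0}"
      unfolding support using upper [of w i] by (intro image_eqI [of _ _ w]) auto
  qed (use fin upper in \<open>auto simp: support\<close>)
  moreover have "c w = 0" if "?I i u + ?I i v < ?I i w" for w i
    using upper [of w i] that by force
  ultimately show ?thesis unfolding c_def by blast
qed

end
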